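(* Let $|v(x)|\lesssim\langle x\rangle^{-4-}$. Let $\phi\in S_1L^2(\mathbb R^4)$ and let $\psi=c_0-G_1v\phi$ with $c_0=\frac1{\|V\|_{L^1}}\int_{\mathbb R^4}v\,T\phi\,dx$, so that $\phi=Uv\psi$. Then $\phi\in S_3L^2$ if and only if $\psi\in L^p(\mathbb R^4)$ for all $2<p\le\infty$.
   Context: $V:\mathbb R^4\to\mathbb R$ is a real-valued potential, not a.e. zero, and $H=(-\Delta)^2+V$. $U(x)=1$ if $V(x)\ge0$ and $U(x)=-1$ if $V(x)<0$; $v=|V|^{1/2}$. $\langle x\rangle=(1+|x|^2)^{1/2}$, and $|v(x)|\lesssim\langle x\rangle^{-a-}$ means $|v(x)|\le C\langle x\rangle^{-a-\epsilon}$ for some $C,\epsilon>0$. $P$ is the orthogonal projection in $L^2(\mathbb R^4)$ onto the span of $v$, $Q=1-P$. $G_1f(x)=-\frac1{8\pi^2}\int_{\mathbb R^4}\log|x-y|\,f(y)\,dy$; $G_2$ is the operator with kernel $|x-y|^2$. $T=U+vG_1v$. $S_1$ is the orthogonal projection onto the kernel of $QTQ$ on $QL^2$ (a finite-rank projection); $S_2$ is the orthogonal projection onto the kernel of $S_1TPTS_1$ on $S_1L^2$; $S_3$ is the orthogonal projection onto the kernel of $S_2vG_2vS_2$ on $S_2L^2$, where $S_2vG_2vS_2$ is the operator on the finite-dimensional space $S_2L^2$ given by the form $(f,g)\mapsto\iint v(x)f(x)|x-y|^2v(y)\overline{g(y)}\,dx\,dy$. *)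

theory Defs
  imports "HOL-Analysis.Analysis"
begin

type_synonym R4 = "real ^ 4"

section \<open>Lebesgue spaces on \<open>\<real>\<^sup>4\<close>\<close>

text \<open>
  Elements of \<open>L\<^sup>p(\<real>\<^sup>4)\<close> are represented by complex-valued Lebesgue measurable functions.
  Equality in \<open>L\<^sup>p\<close> is equality almost everywhere, and every subspace below is a set of functions
  closed under changes on null sets.
\<close>

definition ae_eq :: "(R4 \<Rightarrow> complex) \<Rightarrow> (R4 \<Rightarrow> complex) \<Rightarrow> bool"
  where "ae_eq f g \<longleftrightarrow> (AE x in lebesgue. f x = g x)"

definition Lp :: "ereal \<Rightarrow> (R4 \<Rightarrow> complex) set"
  where "Lp p = {f \<in> borel_measurable lebesgue.
    if p = \<infinity> then \<exists>C::real. AE x in lebesgue. norm (f x) \<le> C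
    else integrable lebesgue (\<lambda>x. norm (f x) powr real_of_ereal p)}"

abbreviation L2 :: "(R4 \<Rightarrow> complex) set"
  where "L2 \<equiv> Lp 2"

definition L2_inner :: "(R4 \<Rightarrow> complex) \<Rightarrow> (R4 \<Rightarrow> complex) \<Rightarrow> complex"
  where "L2_inner f g = (LINT x|lebesgue. f x * cnj (g x))"

section \<open>Projections, ranges and kernels\<close>

text \<open>
  For a closed subspace \<open>M\<close> of \<open>L\<^sup>2\<close> and \<open>f \<in> L\<^sup>2\<close> the function chosen here exists and is unique up
  to null sets; the choice only selects a representative.
\<close>

definition orth_proj :: "(R4 \<Rightarrow> complex) set \<Rightarrow> (R4 \<Rightarrow> complex) \<Rightarrow> R4 \<Rightarrow> complex"
  where "orth_proj M f = (SOME g. g \<in> M \<and> (\<forall>h\<in>M. L2_inner (\<lambda>x. f x - g x) h = 0))"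

definition L2_range :: "((R4 \<Rightarrow> complex) \<Rightarrow> R4 \<Rightarrow> complex) \<Rightarrow> (R4 \<Rightarrow> complex) set"
  where "L2_range A = {f \<in> L2. \<exists>g\<in>L2. ae_eq f (A g)}"

definition kernel_on ::
    "(R4 \<Rightarrow> complex) set \<Rightarrow> ((R4 \<Rightarrow> complex) \<Rightarrow> R4 \<Rightarrow> complex) \<Rightarrow> (R4 \<Rightarrow> complex) set"
  where "kernel_on M A = {f \<in> M. ae_eq (A f) (\<lambda>x. 0)}"

text \<open>
  The operator \<open>A\<close> on \<open>M\<close> given by a sesquilinear form \<open>B\<close>: \<open>A f\<close> is the element of \<open>M\<close> with
  \<open>\<langle>A f, g\<rangle> = B f g\<close> for all \<open>g \<in> M\<close>, again unique up to null sets.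
\<close>

definition form_operator ::
    "(R4 \<Rightarrow> complex) set \<Rightarrow> ((R4 \<Rightarrow> complex) \<Rightarrow> (R4 \<Rightarrow> complex) \<Rightarrow> complex)
      \<Rightarrow> (R4 \<Rightarrow> complex) \<Rightarrow> R4 \<Rightarrow> complex"
  where "form_operator M B f = (SOME h. h \<in> M \<and> (\<forall>g\<in>M. L2_inner h g = B f g))"

section \<open>Potential and decay\<close>

definition U :: "(R4 \<Rightarrow> real) \<Rightarrow> R4 \<Rightarrow> real"
  where "U V x = (if V x \<ge> 0 then 1 else - 1)"

definition v :: "(R4 \<Rightarrow> real) \<Rightarrow> R4 \<Rightarrow> real"
  where "v V x = sqrt \<bar>V x\<bar>"

definition japanese_bracket :: "R4 \<Rightarrow> real"
  where "japanese_bracket x = sqrt (1 + (norm x)\<^sup>2)"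

text \<open>\<open>decays_beyond w a\<close> is the condition \<open>|w(x)| \<lesssim> \<langle>x\<rangle>\<^sup>-\<^sup>a\<^sup>-\<close>.\<close>

definition decays_beyond :: "(R4 \<Rightarrow> real) \<Rightarrow> real \<Rightarrow> bool"
  where "decays_beyond w a \<longleftrightarrow>
    (\<exists>C>0. \<exists>\<epsilon>>0. \<forall>x. \<bar>w x\<bar> \<le> C * japanese_bracket x powr (- a - \<epsilon>))"

section \<open>The operators\<close>

definition G1 :: "(R4 \<Rightarrow> complex) \<Rightarrow> R4 \<Rightarrow> complex"
  where "G1 f x =
    - of_real (1 / (8 * pi\<^sup>2)) * (LINT y|lebesgue. of_real (ln (norm (x - y))) * f y)"

definition op_T :: "(R4 \<Rightarrow> real) \<Rightarrow> (R4 \<Rightarrow> complex) \<Rightarrow> R4 \<Rightarrow> complex"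
  where "op_T V f x =
    of_real (U V x) * f x + of_real (v V x) * G1 (\<lambda>y. of_real (v V y) * f y) x"

definition span_v :: "(R4 \<Rightarrow> real) \<Rightarrow> (R4 \<Rightarrow> complex) set"
  where "span_v V = {f \<in> L2. \<exists>c::complex. ae_eq f (\<lambda>x. c * of_real (v V x))}"

definition op_P :: "(R4 \<Rightarrow> real) \<Rightarrow> (R4 \<Rightarrow> complex) \<Rightarrow> R4 \<Rightarrow> complex"
  where "op_P V = orth_proj (span_v V)"

definition op_Q :: "(R4 \<Rightarrow> real) \<Rightarrow> (R4 \<Rightarrow> complex) \<Rightarrow> R4 \<Rightarrow> complex"
  where "op_Q V f x = f x - op_P V f x"

definition op_S1 :: "(R4 \<Rightarrow> real) \<Rightarrow> (R4 \<Rightarrow> complex) \<Rightarrow> R4 \<Rightarrow> complex"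
  where "op_S1 V = orth_proj (kernel_on (L2_range (op_Q V)) (op_Q V \<circ> op_T V \<circ> op_Q V))"

definition op_S2 :: "(R4 \<Rightarrow> real) \<Rightarrow> (R4 \<Rightarrow> complex) \<Rightarrow> R4 \<Rightarrow> complex"
  where "op_S2 V = orth_proj (kernel_on (L2_range (op_S1 V))
    (op_S1 V \<circ> op_T V \<circ> op_P V \<circ> op_T V \<circ> op_S1 V))"

definition vG2v_form :: "(R4 \<Rightarrow> real) \<Rightarrow> (R4 \<Rightarrow> complex) \<Rightarrow> (R4 \<Rightarrow> complex) \<Rightarrow> complex"
  where "vG2v_form V f g =
    (LINT y|lebesgue. LINT x|lebesgue.
      of_real (v V x) * f x * of_real ((norm (x - y))\<^sup>2) * of_real (v V y) * cnj (g y))"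

definition op_S3 :: "(R4 \<Rightarrow> real) \<Rightarrow> (R4 \<Rightarrow> complex) \<Rightarrow> R4 \<Rightarrow> complex"
  where "op_S3 V = orth_proj (kernel_on (L2_range (op_S2 V))
    (form_operator (L2_range (op_S2 V)) (vG2v_form V)))"

end

theory Submission imports Defs begin

text \<open>
  \<^bold>\<open>The three spaces are orthogonal complements.\<close> \<open>T\<close> is self-adjoint on \<open>L\<^sup>2\<close>, so
  every condition imposed by \<open>S\<^sub>1\<close>, \<open>S\<^sub>2\<close> and \<open>S\<^sub>3\<close> can be written as orthogonality to explicit
  functions.
  Let \<open>\<phi> \<in> L\<^sup>2\<close>.

  \<^item> \<open>QTQ\<phi> = 0\<close> on \<open>QL\<^sup>2\<close> means \<open>\<langle>\<phi>, v\<rangle> = 0\<close> and \<open>T\<phi> = c\<^sub>0 v\<close> for a constant \<open>c\<^sub>0\<close>, which is then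
    the constant of the theorem (\<open>kernel_QTQ\<close>, \<open>mem_S1_iff\<close>). Multiplying \<open>T\<phi> = U\<phi> + vG\<^sub>1v\<phi> = c\<^sub>0v\<close> by \<open>U\<close>
    gives \<open>\<phi> = Uv\<psi>\<close>.
  \<^item> The kernel of \<open>S\<^sub>1TPTS\<^sub>1\<close> adds \<open>c\<^sub>0 = 0\<close>: there \<open>S\<^sub>1TPT\<phi> = c\<^sub>0 S\<^sub>1Tv\<close>, and pairing with \<open>\<phi>\<close>
    itself yields \<open>\<bar>c\<^sub>0\<bar>\<^sup>2 \<parallel>v\<parallel>\<^sup>2\<close> (\<open>kernel_S1TPTS1\<close>).
  \<^item> The kernel of \<open>S\<^sub>2vG\<^sub>2vS\<^sub>2\<close> adds that all first moments \<open>\<integral> x\<^sub>j v\<phi>\<close> vanish. In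
    \<open>\<bar>x - y\<bar>\<^sup>2 = \<bar>x\<bar>\<^sup>2 + \<bar>y\<bar>\<^sup>2 - 2 x\<cdot>y\<close> the first two terms integrate to zero against functions
    orthogonal to \<open>v\<close>, so the form is \<open>- 2\<close> times the inner product of the moment vectors and is
    negative semidefinite (\<open>kernel_S2vG2vS2\<close>).

  The projections exist because orthogonal complements in \<open>L\<^sup>2\<close> are closed and \<open>L\<^sup>2\<close> is complete.

  \<^bold>\<open>These conditions are the leading coefficients of \<open>\<psi>\<close> at infinity.\<close> Expanding \<open>log \<bar>x - y\<bar>\<close> to
  first order in \<open>y\<close> and using \<open>\<integral> v\<phi> = 0\<close> one obtains
  \<open>\<psi>(x) = c\<^sub>0 - (8\<pi>\<^sup>2)\<^sup>-\<^sup>1 \<bar>x\<bar>\<^sup>-\<^sup>2 \<Sum>\<^sub>j x\<^sub>j \<integral> y\<^sub>j v\<phi> + O(\<bar>x\<bar>\<^sup>-\<^sup>2)\<close> (\<open>log_potential_expansion\<close>). The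
  remainder is controlled by the pointwise estimate \<open>log_kernel_expansion\<close> together with
  \<open>inverse_square_kernel_bound\<close>, which handles the logarithmic singularity at \<open>y = x\<close> uniformly
  in \<open>x\<close>.

  If \<open>c\<^sub>0\<close> and the moments vanish, then \<open>\<psi>\<close> is bounded by a multiple of \<open>\<langle>x\<rangle>\<^sup>-\<^sup>2\<close>, whose \<open>p\<close>-th
  power is integrable on \<open>\<real>\<^sup>4\<close> exactly for \<open>p > 2\<close>. Otherwise \<open>\<bar>\<psi>\<bar> \<ge> c/t\<close> on balls
  of radius proportional to \<open>t\<close> and centre at distance \<open>t\<close> from the origin; the integral of
  \<open>\<bar>\<psi>\<bar>\<^sup>3\<close> over such a ball grows like \<open>t\<^sup>-\<^sup>3 t\<^sup>4\<close>, so already \<open>\<psi> \<in> L\<^sup>3\<close> fails.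
\<close>

section \<open>Square-integrable functions\<close>

text \<open>The rule would rewrite \<open>L2\<close>, that is \<open>Lp 2\<close>, to \<open>Lp (ereal 2)\<close>, where no fact about \<open>L2\<close> applies.\<close>

declare numeral_eq_ereal [simp del]

lemma L2_iff: "f \<in> L2 \<longleftrightarrow> f \<in> borel_measurable lebesgue \<and> integrable lebesgue (\<lambda>x. (norm (f x))\<^sup>2)"
  unfolding Lp_def by (simp add: powr_numeral numeral_eq_ereal)

lemma L2_measurable [measurable_dest]: "f \<in> L2 \<Longrightarrow> f \<in> borel_measurable lebesgue"
  by (simp add: L2_iff)

lemma L2_square_integrable: "f \<in> L2 \<Longrightarrow> integrable lebesgue (\<lambda>x. (norm (f x))\<^sup>2)"
  by (simp add: L2_iff)

lemma L2_dominated: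
  assumes "f \<in> borel_measurable lebesgue" "integrable lebesgue w"
    and "AE x in lebesgue. (norm (f x))\<^sup>2 \<le> w x"
  shows "f \<in> L2"
  unfolding L2_iff
proof
  show "integrable lebesgue (\<lambda>x. (norm (f x))\<^sup>2)"
  proof (rule Bochner_Integration.integrable_bound[OF assms(2)])
    show "(\<lambda>x. (norm (f x))\<^sup>2) \<in> borel_measurable lebesgue" using assms(1) by measurable
    show "AE x in lebesgue. norm ((norm (f x))\<^sup>2) \<le> norm (w x)"
      using assms(3) by eventually_elim auto
  qed
qed fact

lemma L2_cmult: "f \<in> L2 \<Longrightarrow> (\<lambda>x. c * f x) \<in> L2"
  by (auto simp: L2_iff norm_mult power_mult_distrib)

lemma L2_add:
  assumes "f \<in> L2" "g \<in> L2" shows "(\<lambda>x. f x + g x) \<in> L2"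
proof (rule L2_dominated)
  show "(\<lambda>x. f x + g x) \<in> borel_measurable lebesgue" using assms by measurable
  show "integrable lebesgue (\<lambda>x. 2 * (norm (f x))\<^sup>2 + 2 * (norm (g x))\<^sup>2)"
    using assms by (auto simp: L2_iff)
  have "(norm (f x + g x))\<^sup>2 \<le> 2 * (norm (f x))\<^sup>2 + 2 * (norm (g x))\<^sup>2" for x
  proof -
    have "(norm (f x + g x))\<^sup>2 \<le> (norm (f x) + norm (g x))\<^sup>2"
      by (intro power_mono norm_triangle_ineq) auto
    also have "\<dots> \<le> 2 * (norm (f x))\<^sup>2 + 2 * (norm (g x))\<^sup>2"
      using sum_squares_bound[of "norm (f x)" "norm (g x)"] by (simp add: power2_sum)
    finally show ?thesis .
  qed
  then show "AE x in lebesgue. (norm (f x + g x))\<^sup>2 \<le> 2 * (norm (f x))\<^sup>2 + 2 * (norm (g x))\<^sup>2"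
    by simp
qed

lemma L2_diff:
  assumes "f \<in> L2" "g \<in> L2" shows "(\<lambda>x. f x - g x) \<in> L2"
  using L2_add[OF assms(1) L2_cmult[OF assms(2), of "-1"]] by simp

lemma L2_zero: "(\<lambda>x. 0) \<in> L2"
  by (simp add: L2_iff)

lemma L2_cnj: "f \<in> L2 \<Longrightarrow> (\<lambda>x. cnj (f x)) \<in> L2"
  by (auto simp: L2_iff intro!: borel_measurable_continuous_on[of cnj] continuous_intros)

lemma L2_mult_integrable:
  assumes "f \<in> L2" "g \<in> L2" shows "integrable lebesgue (\<lambda>x. f x * g x)"
proof (rule Bochner_Integration.integrable_bound)
  show "integrable lebesgue (\<lambda>x. (norm (f x))\<^sup>2 + (norm (g x))\<^sup>2)"
    using assms by (auto simp: L2_iff)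
  show "(\<lambda>x. f x * g x) \<in> borel_measurable lebesgue" using assms by measurable
  have "norm (f x * g x) \<le> norm ((norm (f x))\<^sup>2 + (norm (g x))\<^sup>2)" for x
  proof -
    have "2 * (norm (f x) * norm (g x)) \<le> (norm (f x))\<^sup>2 + (norm (g x))\<^sup>2"
      using sum_squares_bound[of "norm (f x)" "norm (g x)"] by (simp add: mult.assoc)
    moreover have "0 \<le> norm (f x) * norm (g x)" by simp
    ultimately have "norm (f x) * norm (g x) \<le> (norm (f x))\<^sup>2 + (norm (g x))\<^sup>2" by linarith
    then show ?thesis by (simp add: norm_mult)
  qed
  then show "AE x in lebesgue. norm (f x * g x) \<le> norm ((norm (f x))\<^sup>2 + (norm (g x))\<^sup>2)"
    by simp
qed

lemma L2_inner_integrable: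
  assumes "f \<in> L2" "g \<in> L2" shows "integrable lebesgue (\<lambda>x. f x * cnj (g x))"
  using L2_mult_integrable[OF assms(1) L2_cnj[OF assms(2)]] .

lemma L2_inner_diff_left:
  assumes "f \<in> L2" "g \<in> L2" "h \<in> L2"
  shows "L2_inner (\<lambda>x. f x - g x) h = L2_inner f h - L2_inner g h"
  unfolding L2_inner_def
  by (simp add: left_diff_distrib Bochner_Integration.integral_diff L2_inner_integrable assms)

lemma L2_inner_add_left:
  assumes "f \<in> L2" "g \<in> L2" "h \<in> L2"
  shows "L2_inner (\<lambda>x. f x + g x) h = L2_inner f h + L2_inner g h"
  unfolding L2_inner_def
  by (simp add: distrib_right Bochner_Integration.integral_add L2_inner_integrable assms)

lemma L2_inner_cmult_left: "L2_inner (\<lambda>x. c * f x) h = c * L2_inner f h"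
  unfolding L2_inner_def by (simp add: mult.assoc)

lemma L2_inner_cnj: "cnj (L2_inner f g) = L2_inner g f"
  unfolding L2_inner_def by (subst Bochner_Integration.integral_cnj[symmetric]) (simp add: mult.commute)

lemma L2_inner_eq_0_sym: "L2_inner f g = 0 \<longleftrightarrow> L2_inner g f = 0"
  by (metis L2_inner_cnj complex_cnj_zero)

lemma ae_eq_refl: "ae_eq f f" by (simp add: ae_eq_def)
lemma ae_eq_sym: "ae_eq f g \<Longrightarrow> ae_eq g f" by (auto simp: ae_eq_def eq_commute)
lemma ae_eq_trans: "ae_eq f g \<Longrightarrow> ae_eq g h \<Longrightarrow> ae_eq f h"
  unfolding ae_eq_def by (auto elim: eventually_elim2)

lemma ae_eq_diff:
  "ae_eq f f' \<Longrightarrow> ae_eq g g' \<Longrightarrow> ae_eq (\<lambda>x. f x - g x) (\<lambda>x. f' x - g' x)"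
  unfolding ae_eq_def by (auto elim: eventually_elim2)

lemma ae_eq_measurable: "ae_eq f g \<Longrightarrow> f \<in> borel_measurable lebesgue \<Longrightarrow> g \<in> borel_measurable lebesgue"
  unfolding ae_eq_def by (rule borel_measurable_AE)

text \<open>
  No integrability is assumed: Lebesgue measure is complete, so \<open>f\<close> and \<open>g\<close> are measurable together,
  and the integral of a non-measurable function is zero by convention.
\<close>

lemma integral_ae_eq:
  assumes "ae_eq f g" shows "integral\<^sup>L lebesgue f = integral\<^sup>L lebesgue g"
proof (cases "f \<in> borel_measurable lebesgue")
  case True
  with ae_eq_measurable[OF assms] show ?thesis
    using assms unfolding ae_eq_def by (intro integral_cong_AE)
next
  case False
  then have "g \<notin> borel_measurable lebesgue"
    using ae_eq_measurable[OF ae_eq_sym[OF assms]] by blast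
  with False show ?thesis
    by (metis borel_measurable_integrable not_integrable_integral_eq)
qed

lemma ae_eq_mult: "ae_eq f f' \<Longrightarrow> ae_eq g g' \<Longrightarrow> ae_eq (\<lambda>x. f x * g x) (\<lambda>x. f' x * g' x)"
  unfolding ae_eq_def by (auto elim: eventually_elim2)

lemma L2_inner_cong:
  assumes "ae_eq f f'" "ae_eq g g'" shows "L2_inner f g = L2_inner f' g'"
  unfolding L2_inner_def
proof (rule integral_ae_eq, rule ae_eq_mult[OF assms(1)])
  show "ae_eq (\<lambda>x. cnj (g x)) (\<lambda>x. cnj (g' x))"
    using assms(2) unfolding ae_eq_def by eventually_elim simp
qed

lemma L2_ae_eq:
  assumes "f \<in> L2" "ae_eq f g" shows "g \<in> L2"
proof (rule L2_dominated)
  show "g \<in> borel_measurable lebesgue"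
    using assms by (auto intro: ae_eq_measurable)
  show "integrable lebesgue (\<lambda>x. (norm (f x))\<^sup>2)" using assms(1) by (rule L2_square_integrable)
  show "AE x in lebesgue. (norm (g x))\<^sup>2 \<le> (norm (f x))\<^sup>2"
    using assms(2) unfolding ae_eq_def by eventually_elim simp
qed

definition sqnorm :: "(R4 \<Rightarrow> complex) \<Rightarrow> real"
  where "sqnorm f = (LINT x|lebesgue. (norm (f x))\<^sup>2)"

lemma sqnorm_nonneg: "0 \<le> sqnorm f"
  unfolding sqnorm_def by simp

lemma L2_inner_self: "L2_inner f f = of_real (sqnorm f)"
proof -
  have "f x * cnj (f x) = of_real ((norm (f x))\<^sup>2)" for x
    by (rule complex_norm_square[symmetric])
  then show ?thesis unfolding L2_inner_def sqnorm_def by (simp only: integral_complex_of_real)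
qed

lemma sqnorm_eq_0_iff:
  assumes "f \<in> L2" shows "sqnorm f = 0 \<longleftrightarrow> ae_eq f (\<lambda>x. 0)"
  unfolding sqnorm_def ae_eq_def
  by (subst integral_nonneg_eq_0_iff_AE) (use assms in \<open>auto simp: L2_iff\<close>)

lemma L2_inner_self_eq_0_iff:
  assumes "f \<in> L2" shows "L2_inner f f = 0 \<longleftrightarrow> ae_eq f (\<lambda>x. 0)"
  by (simp add: L2_inner_self sqnorm_eq_0_iff[OF assms])

text \<open>
  Subtracting from \<open>f\<close> its component along \<open>h\<close> lowers the squared norm by a known amount. Since the
  result is nonnegative this contains the Cauchy-Schwarz inequality; it also shows below that a
  nearly closest point of a subspace leaves a residual nearly orthogonal to the subspace.
\<close>

lemma sqnorm_diff_projection: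
  assumes f: "f \<in> L2" and h: "h \<in> L2" and pos: "sqnorm h > 0"
  defines "t \<equiv> L2_inner f h / of_real (sqnorm h)"
  shows "sqnorm (\<lambda>x. f x - t * h x) = sqnorm f - (norm (L2_inner f h))\<^sup>2 / sqnorm h"
proof -
  let ?p = "\<lambda>x. f x - t * h x"
  have th: "(\<lambda>x. t * h x) \<in> L2" by (rule L2_cmult[OF h])
  have p: "?p \<in> L2" by (rule L2_diff[OF f th])
  have ph: "L2_inner ?p h = 0"
    using pos by (subst L2_inner_diff_left[OF f th h])
      (simp only: L2_inner_cmult_left L2_inner_self t_def, simp)
  have "of_real (sqnorm ?p) = L2_inner ?p ?p" by (simp add: L2_inner_self)
  also have "\<dots> = L2_inner f ?p - t * L2_inner h ?p"
    by (simp add: L2_inner_diff_left[OF f th p] L2_inner_cmult_left)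
  also have "L2_inner h ?p = 0" using ph by (simp add: L2_inner_eq_0_sym[of h])
  also have "L2_inner f ?p = cnj (L2_inner ?p f)" by (simp add: L2_inner_cnj)
  also have "L2_inner ?p f = of_real (sqnorm f) - t * L2_inner h f"
    by (simp add: L2_inner_diff_left[OF f th f] L2_inner_cmult_left L2_inner_self)
  also have "t * L2_inner h f = of_real ((norm (L2_inner f h))\<^sup>2 / sqnorm h)"
    by (simp add: t_def flip: L2_inner_cnj[of f h] complex_norm_square)
  finally have "complex_of_real (sqnorm ?p) = of_real (sqnorm f - (norm (L2_inner f h))\<^sup>2 / sqnorm h)"
    by simp
  then show ?thesis by (simp only: of_real_eq_iff)
qed

lemma L2_Cauchy_Schwarz:
  assumes f: "f \<in> L2" and h: "h \<in> L2"
  shows "(norm (L2_inner f h))\<^sup>2 \<le> sqnorm f * sqnorm h"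
proof (cases "sqnorm h = 0")
  case True
  then have "ae_eq h (\<lambda>x. 0)" by (simp add: sqnorm_eq_0_iff[OF h])
  from L2_inner_cong[OF ae_eq_refl this] show ?thesis by (simp add: L2_inner_def True)
next
  case False
  then have pos: "sqnorm h > 0" using sqnorm_nonneg[of h] by simp
  have "0 \<le> sqnorm f - (norm (L2_inner f h))\<^sup>2 / sqnorm h"
    unfolding sqnorm_diff_projection[OF f h pos, symmetric] by (rule sqnorm_nonneg)
  then show ?thesis using pos by (simp add: field_simps)
qed

lemma parallelogram_sqnorm:
  assumes a: "a \<in> L2" and b: "b \<in> L2"
  shows "sqnorm (\<lambda>x. a x - b x) = 2 * sqnorm a + 2 * sqnorm b - sqnorm (\<lambda>x. a x + b x)"
proof -
  have eq: "(norm (a x - b x))\<^sup>2 = 2 * (norm (a x))\<^sup>2 + 2 * (norm (b x))\<^sup>2 - (norm (a x + b x))\<^sup>2" for x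
    unfolding cmod_power2 by (simp add: power2_eq_square algebra_simps)
  show ?thesis unfolding sqnorm_def eq
    using a b L2_add[OF a b]
    by (simp add: L2_iff Bochner_Integration.integral_diff Bochner_Integration.integral_add)
qed

lemma nn_integral_sqnorm:
  "f \<in> L2 \<Longrightarrow> (\<integral>\<^sup>+x. ennreal ((norm (f x))\<^sup>2) \<partial>lebesgue) = ennreal (sqnorm f)"
  unfolding sqnorm_def by (rule nn_integral_eq_integral) (auto simp: L2_iff)

text \<open>
  The Riesz-Fischer argument for a sequence with geometrically small increments: it converges almost
  everywhere, and Fatou's lemma turns the pointwise limit into an \<open>L\<^sup>2\<close> limit.
\<close>

lemma L2_complete:
  fixes g :: "nat \<Rightarrow> R4 \<Rightarrow> complex"
  assumes g: "\<And>n. g n \<in> L2" and C: "C \<ge> 0"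
    and cauchy: "\<And>n m. n \<le> m \<Longrightarrow> sqnorm (\<lambda>x. g m x - g n x) \<le> C * (1/16) ^ n"
  obtains l where "l \<in> L2" "(\<lambda>n. sqnorm (\<lambda>x. l x - g n x)) \<longlonglongrightarrow> 0"
proof -
  note [measurable] = g[THEN L2_measurable]
  have d: "(\<lambda>x. g m x - g n x) \<in> L2" for m n by (rule L2_diff[OF g g])
  \<comment> \<open>The squared increments weighted by \<open>4 ^ n\<close> still have a summable series of integrals; where
      their sum is finite, the increments decay geometrically.\<close>
  define w where "w n x = ennreal (4 ^ n) * ennreal ((norm (g (Suc n) x - g n x))\<^sup>2)" for n x
  have wm [measurable]: "w n \<in> borel_measurable lebesgue" for n unfolding w_def by measurable
  have "(\<integral>\<^sup>+x. (\<Sum>n. w n x) \<partial>lebesgue) = (\<Sum>n. \<integral>\<^sup>+x. w n x \<partial>lebesgue)"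
    by (intro nn_integral_suminf wm)
  also have "\<dots> \<le> (\<Sum>n. ennreal (C * (1/4) ^ n))"
  proof (intro suminf_le)
    fix n
    have "(\<integral>\<^sup>+x. w n x \<partial>lebesgue) = ennreal (4 ^ n) * ennreal (sqnorm (\<lambda>x. g (Suc n) x - g n x))"
      unfolding w_def by (subst nn_integral_cmult) (auto simp: nn_integral_sqnorm[OF d])
    also have "\<dots> \<le> ennreal (4 ^ n) * ennreal (C * (1/16) ^ n)"
      by (intro mult_left_mono ennreal_leI cauchy) auto
    also have "\<dots> = ennreal (C * (1/4) ^ n)"
      using C by (simp add: ennreal_mult[symmetric] field_simps flip: power_mult_distrib)
    finally show "(\<integral>\<^sup>+x. w n x \<partial>lebesgue) \<le> ennreal (C * (1/4) ^ n)" .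
  qed auto
  also have "\<dots> < top"
    using C by (subst suminf_ennreal2) (auto intro!: summable_mult summable_geometric)
  finally have "AE x in lebesgue. (\<Sum>n. w n x) \<noteq> \<infinity>"
    by (intro nn_integral_PInf_AE) (auto simp: less_top)
  then have conv: "AE x in lebesgue. convergent (\<lambda>n. g n x)"
  proof eventually_elim
    case (elim x)
    then obtain B where B: "B \<ge> 0" "(\<Sum>n. w n x) = ennreal B"
      by (cases "\<Sum>n. w n x") auto
    have "norm (g (Suc n) x - g n x) \<le> sqrt B * (1/2) ^ n" for n
    proof -
      have "w n x \<le> ennreal B"
        unfolding B(2)[symmetric] using sum_le_suminf[of "\<lambda>n. w n x" "{n}"] by simp
      then have "4 ^ n * (norm (g (Suc n) x - g n x))\<^sup>2 \<le> B"
        using B(1) unfolding w_def by (simp add: ennreal_mult[symmetric])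
      then have "(norm (g (Suc n) x - g n x))\<^sup>2 \<le> B * (1/4) ^ n"
        by (simp add: field_simps power_divide)
      also have "\<dots> = (sqrt B * (1/2) ^ n)\<^sup>2"
      proof -
        have "((1/2::real) ^ n)\<^sup>2 = (1/4) ^ n" by (simp add: power2_eq_square flip: power_mult_distrib)
        then show ?thesis using B(1) by (simp add: power_mult_distrib)
      qed
      finally show ?thesis using B(1) by (simp add: power2_le_iff_abs_le)
    qed
    then have step: "norm (norm (g (Suc n) x - g n x)) \<le> sqrt B * (1/2) ^ n" for n by simp
    have "norm (1/2 :: real) < 1" by simp
    from summable_mult[OF summable_geometric[OF this], of "sqrt B"]
    have "summable (\<lambda>n. norm (g (Suc n) x - g n x))"
      by (rule summable_comparison_test'[where N = 0]) (rule step)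
    then have "summable (\<lambda>n. g (Suc n) x - g n x)" by (rule summable_norm_cancel)
    then have "convergent (\<lambda>n. g n x - g 0 x)"
      unfolding summable_iff_convergent sum_lessThan_telescope[of "\<lambda>n. g n x"] .
    from convergent_add[OF this convergent_const[of "g 0 x"]] show ?case by simp
  qed
  define l where "l x = lim (\<lambda>n. g n x)" for x
  have lm [measurable]: "l \<in> borel_measurable lebesgue" unfolding l_def by measurable
  have lg: "AE x in lebesgue. (\<lambda>n. g n x) \<longlonglongrightarrow> l x"
    using conv by eventually_elim (simp add: l_def convergent_LIMSEQ_iff)
  have bound: "(\<integral>\<^sup>+x. ennreal ((norm (l x - g n x))\<^sup>2) \<partial>lebesgue) \<le> ennreal (C * (1/16) ^ n)" for n
  proof -
    have "(\<integral>\<^sup>+x. ennreal ((norm (l x - g n x))\<^sup>2) \<partial>lebesgue)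
      = (\<integral>\<^sup>+x. liminf (\<lambda>m. ennreal ((norm (g m x - g n x))\<^sup>2)) \<partial>lebesgue)"
    proof (rule nn_integral_cong_AE)
      show "AE x in lebesgue. ennreal ((norm (l x - g n x))\<^sup>2)
          = liminf (\<lambda>m. ennreal ((norm (g m x - g n x))\<^sup>2))"
        using lg
      proof eventually_elim
        case (elim x)
        then have "(\<lambda>m. ennreal ((norm (g m x - g n x))\<^sup>2)) \<longlonglongrightarrow> ennreal ((norm (l x - g n x))\<^sup>2)"
          by (intro tendsto_intros)
        then show ?case by (intro lim_imp_Liminf[symmetric]) auto
      qed
    qed
    also have "\<dots> \<le> liminf (\<lambda>m. \<integral>\<^sup>+x. ennreal ((norm (g m x - g n x))\<^sup>2) \<partial>lebesgue)"
      by (intro nn_integral_liminf) measurable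
    also have "\<dots> = liminf (\<lambda>m. ennreal (sqnorm (\<lambda>x. g m x - g n x)))"
      by (simp add: nn_integral_sqnorm[OF d])
    also have "\<dots> \<le> Limsup sequentially (\<lambda>m. ennreal (sqnorm (\<lambda>x. g m x - g n x)))"
      by (rule Liminf_le_Limsup) simp
    also have "\<dots> \<le> ennreal (C * (1/16) ^ n)"
      by (rule Limsup_bounded) (auto intro!: eventually_sequentiallyI[of n] ennreal_leI cauchy)
    finally show ?thesis .
  qed
  have lgL2: "(\<lambda>x. l x - g n x) \<in> L2" for n
    unfolding L2_iff
  proof
    show "integrable lebesgue (\<lambda>x. (norm (l x - g n x))\<^sup>2)"
      using bound[of n] by (intro integrableI_bounded) (auto intro: le_less_trans)
  qed measurable
  have "l \<in> L2" using L2_add[OF lgL2[of 0] g[of 0]] by simp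
  moreover have "(\<lambda>n. sqnorm (\<lambda>x. l x - g n x)) \<longlonglongrightarrow> 0"
  proof (rule tendsto_sandwich[OF _ _ tendsto_const])
    show "(\<lambda>n. C * (1/16) ^ n) \<longlonglongrightarrow> 0"
      by (intro tendsto_mult_right_zero LIMSEQ_power_zero) auto
    show "\<forall>\<^sub>F n in sequentially. sqnorm (\<lambda>x. l x - g n x) \<le> C * (1/16) ^ n"
      using bound C by (simp add: nn_integral_sqnorm[OF lgL2])
  qed (simp add: sqnorm_nonneg)
  ultimately show ?thesis by (rule that)
qed

section \<open>Orthogonal complements and their projections\<close>

definition perp :: "(R4 \<Rightarrow> complex) set \<Rightarrow> (R4 \<Rightarrow> complex) set"
  where "perp A = {f \<in> L2. \<forall>h\<in>A. L2_inner f h = 0}"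

lemma perp_L2: "f \<in> perp A \<Longrightarrow> f \<in> L2" by (simp add: perp_def)

lemma perp_diff:
  assumes "A \<subseteq> L2" "f \<in> perp A" "g \<in> perp A" shows "(\<lambda>x. f x - g x) \<in> perp A"
  using assms by (auto simp: perp_def L2_diff L2_inner_diff_left subset_iff)

lemma perp_add:
  assumes "A \<subseteq> L2" "f \<in> perp A" "g \<in> perp A" shows "(\<lambda>x. f x + g x) \<in> perp A"
  using assms by (auto simp: perp_def L2_add L2_inner_add_left subset_iff)

lemma perp_cmult: "f \<in> perp A \<Longrightarrow> (\<lambda>x. c * f x) \<in> perp A"
  by (auto simp: perp_def L2_cmult L2_inner_cmult_left)

lemma perp_zero: "(\<lambda>x. 0) \<in> perp A"
  by (auto simp: perp_def L2_zero L2_inner_def)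

lemma perp_ae_eq: "f \<in> perp A \<Longrightarrow> ae_eq f g \<Longrightarrow> g \<in> perp A"
  by (auto simp: perp_def L2_ae_eq L2_inner_cong[OF ae_eq_sym ae_eq_refl])

text \<open>
  A minimizing sequence for the distance from \<open>f\<close> to \<open>perp A\<close> is Cauchy by the parallelogram law.
  Orthogonality of the residual is read off from the approximate minimizers and then passed to the
  limit.
\<close>

lemma perp_projection:
  assumes A: "A \<subseteq> L2" and f: "f \<in> L2"
  shows "\<exists>g\<in>perp A. \<forall>h\<in>perp A. L2_inner (\<lambda>x. f x - g x) h = 0"
proof -
  let ?D = "(\<lambda>g. sqnorm (\<lambda>x. f x - g x)) ` perp A"
  define d where "d = Inf ?D"
  have bdd: "bdd_below ?D" by (auto intro!: bdd_belowI[of _ 0] simp: sqnorm_nonneg)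
  have d_le: "d \<le> sqnorm (\<lambda>x. f x - g x)" if "g \<in> perp A" for g
    unfolding d_def by (rule cInf_lower[OF _ bdd]) (use that in auto)
  have "\<exists>g\<in>perp A. sqnorm (\<lambda>x. f x - g x) < d + (1/16) ^ n" for n :: nat
  proof -
    have "Inf ?D < d + (1/16) ^ n" unfolding d_def by simp
    from cInf_lessD[OF _ this] show ?thesis using perp_zero[of A] by blast
  qed
  then obtain g where g: "\<And>n. g n \<in> perp A" "\<And>n. sqnorm (\<lambda>x. f x - g n x) < d + (1/16) ^ n"
    by metis
  have gL2: "g n \<in> L2" for n using g(1) by (rule perp_L2)
  have fg: "(\<lambda>x. f x - g n x) \<in> L2" for n by (rule L2_diff[OF f gL2])
  have cauchy: "sqnorm (\<lambda>x. g m x - g n x) \<le> 4 * (1/16) ^ n" if "n \<le> m" for n m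
  proof -
    let ?mid = "\<lambda>x. (1/2) * (g n x + g m x)"
    have "sqnorm (\<lambda>x. g m x - g n x) = sqnorm (\<lambda>x. (f x - g n x) - (f x - g m x))" by simp
    also have "\<dots> = 2 * sqnorm (\<lambda>x. f x - g n x) + 2 * sqnorm (\<lambda>x. f x - g m x)
        - sqnorm (\<lambda>x. (f x - g n x) + (f x - g m x))"
      by (rule parallelogram_sqnorm[OF fg fg])
    also have "sqnorm (\<lambda>x. (f x - g n x) + (f x - g m x)) = 4 * sqnorm (\<lambda>x. f x - ?mid x)"
    proof -
      have "(norm ((f x - g n x) + (f x - g m x)))\<^sup>2 = 4 * (norm (f x - ?mid x))\<^sup>2" for x
      proof -
        have "(f x - g n x) + (f x - g m x) = 2 * (f x - ?mid x)" by (simp add: algebra_simps)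
        then show ?thesis by (simp only: norm_mult power_mult_distrib) simp
      qed
      then show ?thesis unfolding sqnorm_def by simp
    qed
    finally have eq: "sqnorm (\<lambda>x. g m x - g n x) = 2 * sqnorm (\<lambda>x. f x - g n x)
        + 2 * sqnorm (\<lambda>x. f x - g m x) - 4 * sqnorm (\<lambda>x. f x - ?mid x)" .
    have mid: "d \<le> sqnorm (\<lambda>x. f x - ?mid x)"
      using d_le[OF perp_cmult[OF perp_add[OF A g(1)[of n] g(1)[of m]], of "1/2"]] by simp
    have pow: "(1/16::real) ^ m \<le> (1/16) ^ n" using that by (intro power_decreasing) auto
    have comb: "\<lbrakk>s = 2 * a + 2 * b - 4 * c; d \<le> c; a < d + p; b < d + q; q \<le> p\<rbrakk> \<Longrightarrow> s \<le> 4 * p"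
      for s a b c p q :: real by argo
    show ?thesis by (rule comb[OF eq mid g(2) g(2) pow])
  qed
  obtain l where l: "l \<in> L2" "(\<lambda>n. sqnorm (\<lambda>x. l x - g n x)) \<longlonglongrightarrow> 0"
    using L2_complete[of g 4] gL2 cauchy by auto
  have lg: "(\<lambda>x. l x - g n x) \<in> L2" for n by (rule L2_diff[OF l(1) gL2])
  have inner_lim: "(\<lambda>n. (norm (L2_inner (\<lambda>x. l x - g n x) h))\<^sup>2) \<longlonglongrightarrow> 0" if h: "h \<in> L2" for h
  proof (rule tendsto_sandwich[OF _ _ tendsto_const])
    show "(\<lambda>n. sqnorm (\<lambda>x. l x - g n x) * sqnorm h) \<longlonglongrightarrow> 0"
      by (rule tendsto_mult_left_zero[OF l(2)])
    show "\<forall>\<^sub>F n in sequentially. (norm (L2_inner (\<lambda>x. l x - g n x) h))\<^sup>2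
        \<le> sqnorm (\<lambda>x. l x - g n x) * sqnorm h"
      using L2_Cauchy_Schwarz[OF lg h] by simp
  qed simp
  have l_perp: "l \<in> perp A"
    unfolding perp_def
  proof (intro CollectI conjI ballI l(1))
    fix h assume "h \<in> A"
    then have h: "h \<in> L2" "\<And>n. L2_inner (g n) h = 0" using A g(1) by (auto simp: perp_def)
    then have "L2_inner (\<lambda>x. l x - g n x) h = L2_inner l h" for n
      by (simp add: L2_inner_diff_left[OF l(1) gL2 h(1)])
    with inner_lim[OF h(1)] show "L2_inner l h = 0" by (simp add: LIMSEQ_const_iff)
  qed
  have fl: "L2_inner (\<lambda>x. f x - l x) h = 0" if h: "h \<in> perp A" for h
  proof (cases "sqnorm h = 0")
    case True
    then have "ae_eq h (\<lambda>x. 0)" by (simp add: sqnorm_eq_0_iff[OF perp_L2[OF h]])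
    from L2_inner_cong[OF ae_eq_refl this] show ?thesis by (simp add: L2_inner_def)
  next
    case False
    then have pos: "sqnorm h > 0" using sqnorm_nonneg[of h] by simp
    have hL2: "h \<in> L2" by (rule perp_L2[OF h])
    \<comment> \<open>Moving from \<open>g n\<close> by the best multiple of \<open>h\<close> cannot bring the squared distance below
        \<open>d\<close>, so the inner product with \<open>h\<close> is small.\<close>
    have near: "(norm (L2_inner (\<lambda>x. f x - g n x) h))\<^sup>2 \<le> (1/16) ^ n * sqnorm h" for n
    proof -
      let ?t = "L2_inner (\<lambda>x. f x - g n x) h / of_real (sqnorm h)"
      have "d \<le> sqnorm (\<lambda>x. f x - (g n x + ?t * h x))"
        by (rule d_le[OF perp_add[OF A g(1) perp_cmult[OF h]]])
      also have "\<dots> = sqnorm (\<lambda>x. f x - g n x - ?t * h x)" by (simp add: algebra_simps)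
      also have "\<dots> = sqnorm (\<lambda>x. f x - g n x) - (norm (L2_inner (\<lambda>x. f x - g n x) h))\<^sup>2 / sqnorm h"
        by (rule sqnorm_diff_projection[OF fg hL2 pos])
      finally have "(norm (L2_inner (\<lambda>x. f x - g n x) h))\<^sup>2 / sqnorm h \<le> (1/16) ^ n"
        using g(2)[of n] by linarith
      then show ?thesis using pos by (simp add: field_simps)
    qed
    have "(\<lambda>n. (norm (L2_inner (\<lambda>x. f x - g n x) h))\<^sup>2) \<longlonglongrightarrow> 0"
    proof (rule tendsto_sandwich[OF _ _ tendsto_const])
      show "(\<lambda>n. (1/16) ^ n * sqnorm h) \<longlonglongrightarrow> 0"
        by (intro tendsto_mult_left_zero LIMSEQ_power_zero) auto
    qed (use near in auto)
    then have "(\<lambda>n. L2_inner (\<lambda>x. f x - g n x) h) \<longlonglongrightarrow> 0"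
      by (simp add: tendsto_norm_zero_iff)
    moreover have "(\<lambda>n. L2_inner (\<lambda>x. l x - g n x) h) \<longlonglongrightarrow> 0"
      using inner_lim[OF hL2] by (simp add: tendsto_norm_zero_iff)
    ultimately have "(\<lambda>n. L2_inner (\<lambda>x. f x - g n x) h - L2_inner (\<lambda>x. l x - g n x) h) \<longlonglongrightarrow> 0 - 0"
      by (rule tendsto_diff)
    then have "(\<lambda>n. L2_inner (\<lambda>x. f x - l x) h) \<longlonglongrightarrow> 0"
      by (simp add: L2_inner_diff_left f l(1) gL2 hL2)
    then show ?thesis by (simp add: LIMSEQ_const_iff)
  qed
  show ?thesis
  proof (rule bexI[OF ballI l_perp])
    fix h assume "h \<in> perp A"
    then show "L2_inner (\<lambda>x. f x - l x) h = 0" by (rule fl)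
  qed
qed

lemma orth_proj_props:
  assumes "\<exists>g\<in>M. \<forall>h\<in>M. L2_inner (\<lambda>x. f x - g x) h = 0"
  shows "orth_proj M f \<in> M" and "\<forall>h\<in>M. L2_inner (\<lambda>x. f x - orth_proj M f x) h = 0"
proof -
  have "\<exists>g. g \<in> M \<and> (\<forall>h\<in>M. L2_inner (\<lambda>x. f x - g x) h = 0)" using assms by (simp add: Bex_def)
  note p = someI_ex[OF this, folded orth_proj_def]
  show "orth_proj M f \<in> M" using p by (rule conjunct1)
  show "\<forall>h\<in>M. L2_inner (\<lambda>x. f x - orth_proj M f x) h = 0" using p by (rule conjunct2)
qed

lemma orth_proj_unique:
  assumes M: "M \<subseteq> L2" "\<And>a b. a \<in> M \<Longrightarrow> b \<in> M \<Longrightarrow> (\<lambda>x. a x - b x) \<in> M" and f: "f \<in> L2"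
    and g: "g \<in> M" "\<And>h. h \<in> M \<Longrightarrow> L2_inner (\<lambda>x. f x - g x) h = 0"
  shows "ae_eq (orth_proj M f) g"
proof -
  let ?p = "orth_proj M f"
  have "\<exists>g\<in>M. \<forall>h\<in>M. L2_inner (\<lambda>x. f x - g x) h = 0"
    by (intro bexI[of _ g] ballI g)
  note p = orth_proj_props(1)[OF this] bspec[OF orth_proj_props(2)[OF this]]
  let ?h = "\<lambda>x. ?p x - g x"
  have h: "?h \<in> M" using M(2) p(1) g(1) .
  have L: "?p \<in> L2" "g \<in> L2" "?h \<in> L2" using M(1) p(1) g(1) h by auto
  have "L2_inner ?h ?h = L2_inner (\<lambda>x. (f x - g x) - (f x - ?p x)) ?h" by simp
  also have "\<dots> = 0"
    by (subst L2_inner_diff_left) (use L f L2_diff g(2)[OF h] p(2)[OF h] in auto)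
  finally have "ae_eq ?h (\<lambda>x. 0)" by (simp add: L2_inner_self_eq_0_iff[OF L(3)])
  then show ?thesis unfolding ae_eq_def by eventually_elim simp
qed

text \<open>
  The choice made by \<open>orth_proj\<close> depends on \<open>f\<close> only through inner products, so almost everywhere
  equal functions have literally the same projection.
\<close>

lemma orth_proj_cong: "ae_eq f f' \<Longrightarrow> orth_proj M f = orth_proj M f'"
proof -
  assume "ae_eq f f'"
  then have "L2_inner (\<lambda>x. f x - g x) h = L2_inner (\<lambda>x. f' x - g x) h" for g h
    by (intro L2_inner_cong ae_eq_diff ae_eq_refl)
  then show ?thesis unfolding orth_proj_def by simp
qed

lemma orth_proj_perp:
  assumes A: "A \<subseteq> L2" and f: "f \<in> L2"
  shows "orth_proj (perp A) f \<in> perp A"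
    and "h \<in> perp A \<Longrightarrow> L2_inner (\<lambda>x. f x - orth_proj (perp A) f x) h = 0"
  using orth_proj_props[OF perp_projection[OF A f]] by blast+

lemma orth_proj_perp_id:
  assumes A: "A \<subseteq> L2" and f: "f \<in> perp A"
  shows "ae_eq (orth_proj (perp A) f) f"
proof (rule orth_proj_unique)
  show "f \<in> L2" "f \<in> perp A" using f by (auto simp: perp_L2)
  show "L2_inner (\<lambda>x. f x - f x) h = 0" for h by (simp add: L2_inner_def)
  show "perp A \<subseteq> L2" by (auto simp: perp_L2)
  show "(\<lambda>x. a x - b x) \<in> perp A" if "a \<in> perp A" "b \<in> perp A" for a b
    using perp_diff[OF A that] .
qed

text \<open>
  This is the step that needs existence of projections: an arbitrary \<open>g \<in> L2\<close> has to be sent into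
  \<open>perp A\<close> by the choice in \<open>orth_proj\<close>.
\<close>

lemma L2_range_orth_proj_perp:
  assumes A: "A \<subseteq> L2" shows "L2_range (orth_proj (perp A)) = perp A"
proof (intro subset_antisym subsetI)
  fix f assume "f \<in> L2_range (orth_proj (perp A))"
  then obtain g where "g \<in> L2" "ae_eq f (orth_proj (perp A) g)" by (auto simp: L2_range_def)
  then show "f \<in> perp A" using perp_ae_eq[OF orth_proj_perp(1)[OF A] ae_eq_sym] by blast
next
  fix f assume f: "f \<in> perp A"
  then show "f \<in> L2_range (orth_proj (perp A))"
    unfolding L2_range_def using perp_L2[OF f] ae_eq_sym[OF orth_proj_perp_id[OF A f]] by auto
qed

lemma orth_proj_perp_eq_0_iff:
  assumes A: "A \<subseteq> L2" and f: "f \<in> L2"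
  shows "ae_eq (orth_proj (perp A) f) (\<lambda>x. 0) \<longleftrightarrow> (\<forall>h\<in>perp A. L2_inner f h = 0)"
proof
  assume 0: "ae_eq (orth_proj (perp A) f) (\<lambda>x. 0)"
  show "\<forall>h\<in>perp A. L2_inner f h = 0"
  proof
    fix h assume h: "h \<in> perp A"
    have "L2_inner (\<lambda>x. f x - orth_proj (perp A) f x) h = L2_inner (\<lambda>x. f x - 0) h"
      by (intro L2_inner_cong ae_eq_diff ae_eq_refl 0)
    with orth_proj_perp(2)[OF A f h] show "L2_inner f h = 0" by simp
  qed
next
  assume 0: "\<forall>h\<in>perp A. L2_inner f h = 0"
  show "ae_eq (orth_proj (perp A) f) (\<lambda>x. 0)"
  proof (rule orth_proj_unique)
    show "perp A \<subseteq> L2" by (auto simp: perp_L2)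
    show "(\<lambda>x. a x - b x) \<in> perp A" if "a \<in> perp A" "b \<in> perp A" for a b
      using perp_diff[OF A that] .
    show "L2_inner (\<lambda>x. f x - 0) h = 0" if "h \<in> perp A" for h using 0 that by simp
    show "f \<in> L2" by (rule f)
    show "(\<lambda>x. 0) \<in> perp A" by (rule perp_zero)
  qed
qed

section \<open>Integrability of weights on four-dimensional space\<close>

lemma sigma_finite_lebesgue: "sigma_finite_measure (lebesgue :: 'a::euclidean_space measure)"
proof
  obtain A :: "'a set set" where A: "countable A" "A \<subseteq> sets lborel" "\<Union>A = space lborel"
    "\<forall>a\<in>A. emeasure lborel a \<noteq> \<infinity>"
    using lborel.sigma_finite_countable by auto
  have "A \<subseteq> sets lebesgue" using A(2) by auto
  moreover have "emeasure lebesgue a \<noteq> \<infinity>" if "a \<in> A" for a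
    using A(2,4) that by (simp add: subset_iff)
  ultimately show "\<exists>A::'a set set. countable A \<and> A \<subseteq> sets lebesgue \<and> \<Union>A = space lebesgue \<and>
      (\<forall>a\<in>A. emeasure lebesgue a \<noteq> \<infinity>)"
    using A(1,3) by (intro exI[of _ A]) simp
qed

interpretation lebesgue_R4: sigma_finite_measure "lebesgue :: R4 measure"
  by (rule sigma_finite_lebesgue)

interpretation lebesgue_R4_pair: pair_sigma_finite "lebesgue :: R4 measure" "lebesgue :: R4 measure" ..

lemma integrable_lebesgue_bound:
  fixes f :: "R4 \<Rightarrow> 'b::euclidean_space" and g :: "R4 \<Rightarrow> real"
  assumes "integrable lebesgue g" "f \<in> borel_measurable lebesgue" "AE y in lebesgue. norm (f y) \<le> g y"
  shows "integrable lebesgue f" "norm (integral\<^sup>L lebesgue f) \<le> integral\<^sup>L lebesgue g"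
proof -
  show i: "integrable lebesgue f"
    by (rule Bochner_Integration.integrable_bound[OF assms(1,2)]) (use assms(3) in \<open>eventually_elim, simp\<close>)
  have "norm (integral\<^sup>L lebesgue f) \<le> (LINT y|lebesgue. norm (f y))" by (rule integral_norm_bound)
  also have "\<dots> \<le> integral\<^sup>L lebesgue g"
    by (intro integral_mono_AE integrable_norm i assms)
  finally show "norm (integral\<^sup>L lebesgue f) \<le> integral\<^sup>L lebesgue g" .
qed

text \<open>
  Replaces polar coordinates: \<open>f\<close> lies below \<open>\<Sum>\<^sub>k c\<^sub>k 1\<^bsub>B(0, r\<^sub>k)\<^esub>\<close>, whose integral is
  \<open>vol(B(0,1)) \<Sum>\<^sub>k c\<^sub>k r\<^sub>k\<^sup>4\<close>. Growing radii \<open>2\<^sup>k\<close> test decay at infinity, shrinking radii \<open>2\<^sup>-\<^sup>k\<close>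
  test singularities at the origin.
\<close>

lemma integrable_dyadic_layers:
  fixes f :: "R4 \<Rightarrow> real"
  assumes f: "f \<in> borel_measurable borel" and f0: "\<And>x. 0 \<le> f x"
    and layer: "\<And>x. f x \<noteq> 0 \<Longrightarrow> \<exists>k. norm x < r k \<and> f x \<le> c k"
    and r: "\<And>k. 0 \<le> r k" and c: "\<And>k. 0 \<le> c k" and sm: "summable (\<lambda>k. c k * r k ^ 4)"
  shows "integrable lebesgue f"
proof -
  let ?u = "unit_ball_vol 4"
  have "(\<integral>\<^sup>+x. ennreal (f x) \<partial>lborel) \<le> (\<integral>\<^sup>+x. (\<Sum>k. ennreal (c k) * indicator (ball (0 :: R4) (r k)) x) \<partial>lborel)"
  proof (rule nn_integral_mono)
    fix x :: R4
    show "ennreal (f x) \<le> (\<Sum>k. ennreal (c k) * indicator (ball 0 (r k)) x)"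
    proof (cases "f x = 0")
      case False
      then obtain k where k: "norm x < r k" "f x \<le> c k" using layer by blast
      define F where "F i = ennreal (c i) * indicator (ball 0 (r i)) x" for i
      have "ennreal (f x) \<le> F k"
        using k by (simp add: F_def ennreal_leI)
      also have "F k \<le> suminf F" using sum_le_suminf[of F "{k}"] by simp
      finally show ?thesis unfolding F_def[abs_def] .
    qed simp
  qed
  also have "\<dots> = (\<Sum>k. \<integral>\<^sup>+x. ennreal (c k) * indicator (ball 0 (r k)) (x :: R4) \<partial>lborel)"
    by (intro nn_integral_suminf borel_measurable_times_ennreal borel_measurable_const borel_measurable_indicator) simp
  also have "\<dots> = (\<Sum>k. ennreal (?u * (c k * r k ^ 4)))"
    by (intro suminf_cong)
       (simp add: nn_integral_cmult_indicator emeasure_ball[OF r] ennreal_mult'[OF c, symmetric] power4_eq_xxxx ac_simps)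
  also have "\<dots> < \<infinity>"
    using summable_mult[OF sm, of ?u] r c
    by (subst suminf_ennreal2) auto
  finally have "integrable lborel f" using f f0 by (intro integrableI_bounded) auto
  then show ?thesis using f by (simp add: integrable_completion)
qed

lemma japanese_bracket_ge_1: "1 \<le> japanese_bracket x"
  by (simp add: japanese_bracket_def)

lemma japanese_bracket_pos: "0 < japanese_bracket x"
  using japanese_bracket_ge_1[of x] by linarith

lemma norm_le_japanese_bracket: "norm x \<le> japanese_bracket x"
  by (simp add: japanese_bracket_def real_le_rsqrt)

lemma japanese_bracket_measurable [measurable]: "japanese_bracket \<in> borel_measurable borel"
  unfolding japanese_bracket_def by measurable

lemma integrable_japanese_bracket:
  assumes a: "4 < a" shows "integrable lebesgue (\<lambda>x. japanese_bracket x powr (- a))"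
proof (rule integrable_dyadic_layers[where r = "\<lambda>k. 2 ^ Suc k" and c = "\<lambda>k. (2 powr (- a)) ^ k"])
  fix x :: R4
  have "\<exists>k. japanese_bracket x < 2 ^ Suc k"
    by (meson real_arch_pow one_less_numeral_iff semiring_norm(76) less_trans power_strict_increasing lessI)
  define k where "k = (LEAST k. japanese_bracket x < 2 ^ Suc k)"
  have up: "japanese_bracket x < 2 ^ Suc k"
    unfolding k_def by (rule LeastI_ex) fact
  have low: "2 ^ k \<le> japanese_bracket x"
  proof (cases k)
    case 0 then show ?thesis by (simp add: japanese_bracket_ge_1)
  next
    case (Suc j)
    then have "\<not> japanese_bracket x < 2 ^ Suc j"
      using not_less_Least[of j "\<lambda>k. japanese_bracket x < 2 ^ Suc k"] by (simp add: k_def)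
    with Suc show ?thesis by simp
  qed
  have "japanese_bracket x powr (- a) \<le> (2 ^ k) powr (- a)"
    using low a by (intro powr_mono2') auto
  also have "(2 ^ k) powr (- a) = (2 powr (- a)) ^ k"
    by (simp add: powr_powr powr_realpow[symmetric] mult.commute)
  finally show "\<exists>k. norm x < 2 ^ Suc k \<and> japanese_bracket x powr (- a) \<le> (2 powr (- a)) ^ k"
    using le_less_trans[OF norm_le_japanese_bracket up] by blast
next
  have eq: "(2 powr (- a)) ^ k * (2 ^ Suc k) ^ 4 = 16 * (2 powr (4 - a)) ^ k" for k
  proof -
    have "(2 powr (4 - a)) ^ k = (2 powr (- a)) ^ k * 16 ^ k"
      by (simp add: powr_diff powr_minus field_simps flip: power_mult_distrib)
    moreover have "((2::real) ^ Suc k) ^ 4 = 16 * 16 ^ k"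
      by (simp add: numeral_eq_Suc flip: power_mult_distrib)
    ultimately show ?thesis by simp
  qed
  have "2 powr (4 - a) < 1" using powr_less_mono[of "4 - a" 0 2] a by simp
  then show "summable (\<lambda>k. (2 powr (- a)) ^ k * (2 ^ Suc k) ^ 4)"
    unfolding eq by (simp add: summable_mult summable_geometric)
qed auto

definition local_inverse_square :: "R4 \<Rightarrow> real"
  where "local_inverse_square z = (if norm z < 1 then 1 / (norm z)\<^sup>2 else 0)"

lemma local_inverse_square_measurable [measurable]: "local_inverse_square \<in> borel_measurable borel"
  unfolding local_inverse_square_def by measurable

lemma integrable_local_inverse_square: "integrable lebesgue local_inverse_square"
proof (rule integrable_dyadic_layers[where r = "\<lambda>k. (1/2) ^ k" and c = "\<lambda>k. 4 ^ Suc k"])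
  fix z assume "local_inverse_square z \<noteq> 0"
  then have z: "0 < norm z" "norm z < 1" by (auto simp: local_inverse_square_def split: if_splits)
  have "\<exists>k. (1/2) ^ Suc k \<le> norm z"
  proof -
    obtain n where "(1/2) ^ n < norm z" using real_arch_pow_inv[OF z(1), of "1/2"] by auto
    moreover have "(1/2 :: real) ^ Suc n \<le> (1/2) ^ n" by simp
    ultimately show ?thesis by (meson less_imp_le order_trans)
  qed
  define k where "k = (LEAST k. (1/2) ^ Suc k \<le> norm z)"
  have low: "(1/2) ^ Suc k \<le> norm z"
    unfolding k_def by (rule LeastI_ex) fact
  have up: "norm z < (1/2) ^ k"
  proof (cases k)
    case 0 then show ?thesis using z by simp
  next
    case (Suc j)
    then have "\<not> (1/2) ^ Suc j \<le> norm z"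
      using not_less_Least[of j "\<lambda>k. (1/2) ^ Suc k \<le> norm z"] by (simp add: k_def)
    with Suc show ?thesis by simp
  qed
  have "((1/2) ^ Suc k)\<^sup>2 \<le> (norm z)\<^sup>2" using low by (intro power_mono) auto
  then have "1 / (norm z)\<^sup>2 \<le> 1 / ((1/2) ^ Suc k)\<^sup>2" using z by (intro divide_left_mono) auto
  also have "1 / ((1/2 :: real) ^ Suc k)\<^sup>2 = 4 ^ Suc k"
    by (simp add: power2_eq_square power_divide flip: power_mult_distrib)
  finally show "\<exists>k. norm z < (1/2) ^ k \<and> local_inverse_square z \<le> 4 ^ Suc k"
    using up z by (auto simp: local_inverse_square_def)
next
  have eq: "4 ^ Suc k * ((1/2::real) ^ k) ^ 4 = 4 * (1/4) ^ k" for k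
  proof -
    have "((1/2::real) ^ k) ^ 4 = (1/16) ^ k" 
      by (simp add: numeral_eq_Suc flip: power_mult_distrib)
    then show ?thesis by (simp flip: power_mult_distrib)
  qed
  show "summable (\<lambda>k. 4 ^ Suc k * ((1/2::real) ^ k) ^ 4)"
    unfolding eq by (simp add: summable_mult summable_geometric)
qed (auto simp: local_inverse_square_def)

lemma lebesgue_translate:
  fixes f :: "R4 \<Rightarrow> real"
  assumes f: "f \<in> borel_measurable borel" and i: "integrable lebesgue f"
  shows "integrable lebesgue (\<lambda>y. f (y - x))" "(LINT y|lebesgue. f (y - x)) = integral\<^sup>L lebesgue f"
proof -
  have f': "f \<in> borel_measurable lborel" using f by simp
  have m: "(\<lambda>y. f (y - x)) \<in> borel_measurable lborel" using f by measurable
  have shift: "(+) (- x) \<in> lborel \<rightarrow>\<^sub>M borel" by measurable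
  have eq: "f (- x + y) = f (y - x)" for y by (simp add: algebra_simps)
  have "integrable (distr lborel borel ((+) (- x))) f"
    using i unfolding lborel_distr_plus integrable_completion[OF f'] .
  then have "integrable lborel (\<lambda>y. f (y - x))"
    unfolding integrable_distr_eq[OF shift f] eq .
  then show "integrable lebesgue (\<lambda>y. f (y - x))" unfolding integrable_completion[OF m] .
  have "(LINT y|lborel. f (y - x)) = integral\<^sup>L (distr lborel borel ((+) (- x))) f"
    unfolding integral_distr[OF shift f] eq ..
  then show "(LINT y|lebesgue. f (y - x)) = integral\<^sup>L lebesgue f"
    unfolding lborel_distr_plus integral_completion[OF m] integral_completion[OF f'] .
qed

text \<open>
  For \<open>\<bar>x - y\<bar> < 1\<close> the weight is at most one and the locally integrable singularity remains. For
  \<open>\<bar>x - y\<bar> \<ge> 1\<close> the product of the two decaying factors, of orders \<open>2 + s\<close> and \<open>2\<close>, is at most the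
  \<open>(4 + s)\<close>-th power of the larger of \<open>\<langle>y\<rangle>\<^sup>-\<^sup>1\<close> and \<open>\<bar>x - y\<bar>\<^sup>-\<^sup>1\<close>. Each of the three bounds is a fixed
  integrable function of \<open>y\<close> or of \<open>y - x\<close>, hence the uniformity in \<open>x\<close>.
\<close>

lemma inverse_square_kernel_bound:
  assumes s: "0 < s"
  obtains K where "\<And>x. integrable lebesgue (\<lambda>y. japanese_bracket y powr (- (2 + s)) / (norm (x - y))\<^sup>2)"
    and "\<And>x. (LINT y|lebesgue. japanese_bracket y powr (- (2 + s)) / (norm (x - y))\<^sup>2) \<le> K"
proof -
  let ?p = "4 + s"
  let ?h = "\<lambda>z. japanese_bracket z powr (- ?p)"
  let ?k = local_inverse_square
  let ?b = "\<lambda>x y. ?k (y - x) + ?h y + 2 powr (?p / 2) * ?h (y - x)"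
  have hm: "?h \<in> borel_measurable borel" by measurable
  have hi: "integrable lebesgue ?h" using s by (intro integrable_japanese_bracket) auto
  have k0: "0 \<le> ?k z" for z by (simp add: local_inverse_square_def)
  have b_ge: "?k (y - x) \<le> ?b x y" "?h y \<le> ?b x y" "2 powr (?p / 2) * ?h (y - x) \<le> ?b x y" for x y
  proof -
    have nn: "0 \<le> ?k (y - x)" "0 \<le> ?h y" "0 \<le> 2 powr (?p / 2) * ?h (y - x)"
      by (auto simp: k0)
    show "?k (y - x) \<le> ?b x y" "?h y \<le> ?b x y" "2 powr (?p / 2) * ?h (y - x) \<le> ?b x y"
      using nn by linarith+
  qed
  have bound: "japanese_bracket y powr (- (2 + s)) / (norm (x - y))\<^sup>2 \<le> ?b x y" for x y
  proof (cases "norm (x - y) < 1")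
    case True
    have "japanese_bracket y powr (- (2 + s)) \<le> 1 powr (- (2 + s))"
      using s japanese_bracket_ge_1 by (intro powr_mono2') auto
    then have "japanese_bracket y powr (- (2 + s)) / (norm (x - y))\<^sup>2 \<le> 1 / (norm (x - y))\<^sup>2"
      by (intro divide_right_mono) auto
    also have "\<dots> = ?k (y - x)" using True by (simp add: local_inverse_square_def norm_minus_commute)
    finally show ?thesis using b_ge(1)[of y x] by linarith
  next
    case False
    then have d: "1 \<le> norm (x - y)" by simp
    have "norm (x - y) powr (- 2) = 1 / (norm (x - y))\<^sup>2"
      using d by (simp add: powr_minus_divide powr_numeral)
    then have sq: "japanese_bracket y powr (- (2 + s)) / (norm (x - y))\<^sup>2
        = japanese_bracket y powr (- (2 + s)) * norm (x - y) powr (- 2)" by simp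
    show ?thesis
    proof (cases "japanese_bracket y \<le> norm (x - y)")
      case True
      then have "norm (x - y) powr (- 2) \<le> japanese_bracket y powr (- 2)"
        using japanese_bracket_pos by (intro powr_mono2') auto
      then have "japanese_bracket y powr (- (2 + s)) * norm (x - y) powr (- 2)
          \<le> japanese_bracket y powr (- (2 + s)) * japanese_bracket y powr (- 2)"
        by (intro mult_left_mono) auto
      also have "\<dots> = ?h y" by (simp add: powr_add[symmetric])
      finally show ?thesis using b_ge(2)[of y x] unfolding sq by linarith
    next
      case F: False
      then have "japanese_bracket y powr (- (2 + s)) \<le> norm (x - y) powr (- (2 + s))"
        using d s by (intro powr_mono2') auto
      then have "japanese_bracket y powr (- (2 + s)) * norm (x - y) powr (- 2)
          \<le> norm (x - y) powr (- (2 + s)) * norm (x - y) powr (- 2)"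
        by (intro mult_right_mono) auto
      also have "\<dots> = norm (x - y) powr (- ?p)" by (simp add: powr_add[symmetric])
      also have "\<dots> \<le> 2 powr (?p / 2) * ?h (y - x)"
      proof -
        have "1 \<le> (norm (y - x))\<^sup>2" using d by (simp add: norm_minus_commute)
        then have "japanese_bracket (y - x) \<le> sqrt (2 * (norm (y - x))\<^sup>2)"
          unfolding japanese_bracket_def by (intro real_sqrt_le_mono) simp
        also have "\<dots> = sqrt 2 * norm (x - y)" by (simp add: real_sqrt_mult norm_minus_commute)
        finally have "(sqrt 2 * norm (x - y)) powr (- ?p) \<le> ?h (y - x)"
          using s japanese_bracket_pos by (intro powr_mono2') auto
        moreover have "(sqrt 2 * norm (x - y)) powr (- ?p) = 2 powr (- (?p / 2)) * norm (x - y) powr (- ?p)"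
          by (simp add: powr_mult powr_half_sqrt[symmetric] powr_powr diff_divide_distrib add_divide_distrib)
        ultimately have "2 powr (?p / 2) * (2 powr (- (?p / 2)) * norm (x - y) powr (- ?p))
            \<le> 2 powr (?p / 2) * ?h (y - x)" by (intro mult_left_mono) auto
        moreover have "2 powr (?p / 2) * 2 powr (- (?p / 2)) = 1" by (simp add: powr_minus)
        ultimately show ?thesis by (simp only: mult.assoc[symmetric] mult_1_left)
      qed
      finally show ?thesis using b_ge(3)[of y x] unfolding sq by linarith
    qed
  qed
  have bi: "integrable lebesgue (?b x)" for x
    using lebesgue_translate(1)[OF hm hi, of x] lebesgue_translate(1)[OF _ integrable_local_inverse_square, of x] hi
    by simp
  have bI: "integral\<^sup>L lebesgue (?b x)
      = integral\<^sup>L lebesgue ?k + integral\<^sup>L lebesgue ?h + 2 powr (?p / 2) * integral\<^sup>L lebesgue ?h" for x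
    using lebesgue_translate[OF hm hi, of x] lebesgue_translate[OF _ integrable_local_inverse_square, of x] hi
    by simp
  have m: "(\<lambda>y. japanese_bracket y powr (- (2 + s)) / (norm (x - y))\<^sup>2) \<in> borel_measurable lebesgue" for x
    by (intro measurable_completion) measurable
  note r = integrable_lebesgue_bound[OF bi m]
  show ?thesis
  proof (rule that)
    fix x
    have ae: "AE y in lebesgue. norm (japanese_bracket y powr (- (2 + s)) / (norm (x - y))\<^sup>2) \<le> ?b x y"
      using bound by simp
    show "integrable lebesgue (\<lambda>y. japanese_bracket y powr (- (2 + s)) / (norm (x - y))\<^sup>2)"
      by (rule r(1)[OF ae])
    show "(LINT y|lebesgue. japanese_bracket y powr (- (2 + s)) / (norm (x - y))\<^sup>2)
      \<le> integral\<^sup>L lebesgue ?k + integral\<^sup>L lebesgue ?h + 2 powr (?p / 2) * integral\<^sup>L lebesgue ?h"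
      using r(2)[OF ae] unfolding bI by simp
  qed
qed

section \<open>Pointwise estimates for the logarithmic kernel\<close>

lemma abs_ln_le: 
  fixes t :: real assumes "0 < t" shows "\<bar>ln t\<bar> \<le> t + 1 / t"
proof -
  have "ln t \<le> t - 1" using assms by (rule ln_le_minus_one)
  moreover have "- ln t \<le> 1 / t - 1" using ln_le_minus_one[of "1 / t"] assms by (simp add: ln_div)
  moreover have "0 < 1 / t" using assms by simp
  ultimately show ?thesis using assms by linarith
qed

lemma abs_ln_norm_le:
  fixes x y :: "'a::real_normed_vector"
  shows "\<bar>ln (norm (x - y))\<bar> \<le> norm x + norm y + 1 / norm (x - y)"
proof (cases "x = y")
  case False
  then have "\<bar>ln (norm (x - y))\<bar> \<le> norm (x - y) + 1 / norm (x - y)" by (intro abs_ln_le) simp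
  with norm_triangle_ineq4[of x y] show ?thesis by linarith
qed simp

lemma ln_add_one_minus_bound:
  fixes u :: real assumes "- 3/4 \<le> u" shows "\<bar>ln (1 + u) - u\<bar> \<le> 4 * u\<^sup>2"
proof -
  have pos: "0 < 1 + u" using assms by simp
  have 1: "ln (1 + u) \<le> u" using ln_le_minus_one[OF pos] by simp
  have "- ln (1 + u) \<le> 1 / (1 + u) - 1"
    using ln_le_minus_one[of "1 / (1 + u)"] pos by (simp add: ln_div)
  also have "1 / (1 + u) - 1 = u\<^sup>2 / (1 + u) - u" using pos by (simp add: field_simps power2_eq_square)
  also have "u\<^sup>2 / (1 + u) \<le> u\<^sup>2 / (1/4)" using assms by (intro divide_left_mono) auto
  finally show ?thesis using 1 by simp
qed

text \<open>
  For \<open>\<bar>y\<bar> \<le> \<bar>x\<bar>/2\<close> this is Taylor's formula for \<open>\<bar>x - y\<bar>\<^sup>2 = \<bar>x\<bar>\<^sup>2 (1 + u)\<close>. For \<open>\<bar>y\<bar> > \<bar>x\<bar>/2\<close> nothing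
  is expanded: \<open>\<bar>log t\<bar> \<le> t + 1/t\<close> with \<open>t = \<bar>x - y\<bar>/\<bar>x\<bar>\<close>, and powers of \<open>\<bar>x\<bar>\<close> are traded for powers
  of \<open>\<bar>y\<bar>\<close>. The term with \<open>1/\<bar>x - y\<bar>\<close> dominates the logarithmic singularity by one that is still
  square integrable near \<open>y = x\<close>.
\<close>

lemma log_kernel_expansion:
  fixes x y :: "'a::real_inner"
  assumes x: "x \<noteq> 0" and xy: "x \<noteq> y"
  shows "(norm x)\<^sup>2 * \<bar>ln (norm (x - y)) - ln (norm x) + (x \<bullet> y) / (norm x)\<^sup>2\<bar>
    \<le> 13 * (norm y)\<^sup>2 + 8 * (norm y) ^ 3 / norm (x - y)"
proof (cases "norm y \<le> norm x / 2")
  case True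
  define r where "r = norm x"
  define s where "s = norm y / norm x"
  define q where "q = (x \<bullet> y) / (norm x)\<^sup>2"
  define u where "u = s\<^sup>2 - 2 * q"
  have r: "0 < r" using x by (simp add: r_def)
  have s: "0 \<le> s" "s \<le> 1/2" using True x by (auto simp: s_def field_simps)
  have cs: "\<bar>q\<bar> \<le> s"
    using Cauchy_Schwarz_ineq2[of x y] x by (simp add: q_def s_def field_simps power2_eq_square)
  have s2: "s\<^sup>2 \<le> s / 2" using s using mult_left_mono[of s "1/2" s] by (simp add: power2_eq_square)
  have "0 \<le> (1/2 - s) * (3/2 - s)" using s by (intro mult_nonneg_nonneg) auto
  moreover have "(1/2 - s) * (3/2 - s) = s\<^sup>2 - 2 * s + 3/4" by (simp add: power2_eq_square field_simps)
  ultimately have "- 3/4 \<le> s\<^sup>2 - 2 * s" by linarith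
  with cs have u_lo: "- 3/4 \<le> u" unfolding u_def by (auto simp: abs_le_iff)
  have "\<bar>u\<bar> \<le> 5/2 * s"
  proof -
    have "0 \<le> t \<Longrightarrow> t \<le> s / 2 \<Longrightarrow> \<bar>t - 2 * q\<bar> \<le> 5/2 * s" for t
      using cs by linarith
    from this[OF zero_le_power2 s2] show ?thesis unfolding u_def .
  qed
  then have "\<bar>u\<bar>\<^sup>2 \<le> (5/2 * s)\<^sup>2" by (intro power_mono) auto
  then have usq: "u\<^sup>2 \<le> 25/4 * s\<^sup>2" by (simp add: power_mult_distrib power_divide)
  have "(norm (x - y))\<^sup>2 = (norm x)\<^sup>2 * (1 + u)"
  proof -
    have "(norm (x - y))\<^sup>2 = (norm x)\<^sup>2 + (norm y)\<^sup>2 - 2 * (x \<bullet> y)"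
      by (simp add: power2_norm_eq_inner inner_diff inner_commute)
    moreover have "(norm x)\<^sup>2 * s\<^sup>2 = (norm y)\<^sup>2" using x by (simp add: s_def power_divide)
    moreover have "(norm x)\<^sup>2 * q = x \<bullet> y" using x by (simp add: q_def)
    ultimately show ?thesis unfolding u_def by (simp add: algebra_simps)
  qed
  then have "ln ((norm (x - y))\<^sup>2) = ln ((norm x)\<^sup>2) + ln (1 + u)"
    using x u_lo by (simp add: ln_mult)
  then have "2 * ln (norm (x - y)) = 2 * ln (norm x) + ln (1 + u)"
    using x xy by (simp add: ln_realpow)
  then have "ln (norm (x - y)) - ln (norm x) + (x \<bullet> y) / (norm x)\<^sup>2 = (ln (1 + u) - u) / 2 + s\<^sup>2 / 2"
    unfolding q_def[symmetric] by (simp add: u_def field_simps)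
  also have "\<bar>\<dots>\<bar> \<le> 13 * s\<^sup>2"
  proof -
    have "\<bar>l\<bar> \<le> 4 * b \<Longrightarrow> b \<le> 25/4 * a \<Longrightarrow> 0 \<le> a \<Longrightarrow> \<bar>l / 2 + a / 2\<bar> \<le> 13 * a" for l a b :: real
      by (auto simp: abs_le_iff)
    from this[OF ln_add_one_minus_bound[OF u_lo] usq] show ?thesis by simp
  qed
  finally have "(norm x)\<^sup>2 * \<bar>ln (norm (x - y)) - ln (norm x) + (x \<bullet> y) / (norm x)\<^sup>2\<bar>
      \<le> (norm x)\<^sup>2 * (13 * s\<^sup>2)" by (intro mult_left_mono) auto
  also have "\<dots> = 13 * (norm y)\<^sup>2" using x by (simp add: s_def power_divide)
  also have "\<dots> \<le> 13 * (norm y)\<^sup>2 + 8 * (norm y) ^ 3 / norm (x - y)" by simp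
  finally show ?thesis .
next
  case False
  let ?X = "norm x" and ?Y = "norm y" and ?D = "norm (x - y)"
  have X: "0 < ?X" "?X \<le> 2 * ?Y" and D: "0 < ?D" using False x xy by auto
  have "ln ?D - ln ?X = ln (?D / ?X)" using X D by (simp add: ln_div)
  also have "\<bar>\<dots>\<bar> \<le> ?D / ?X + ?X / ?D" using abs_ln_le[of "?D / ?X"] X D by simp
  finally have 1: "\<bar>ln ?D - ln ?X\<bar> \<le> ?D / ?X + ?X / ?D" .
  have 2: "\<bar>(x \<bullet> y) / ?X\<^sup>2\<bar> \<le> ?Y / ?X"
    using Cauchy_Schwarz_ineq2[of x y] X by (simp add: field_simps power2_eq_square)
  have "?X\<^sup>2 * \<bar>ln ?D - ln ?X + (x \<bullet> y) / ?X\<^sup>2\<bar> \<le> ?X\<^sup>2 * (?D / ?X + ?X / ?D + ?Y / ?X)"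
    by (intro mult_left_mono order_trans[OF abs_triangle_ineq add_mono[OF 1 2]]) auto
  also have "\<dots> = ?X * ?D + ?X ^ 3 / ?D + ?X * ?Y"
    using X D by (simp add: field_simps power2_eq_square power3_eq_cube)
  also have "?X * ?D \<le> (2 * ?Y) * (3 * ?Y)"
    using norm_triangle_ineq4[of x y] X by (intro mult_mono) auto
  also have "?X ^ 3 / ?D \<le> (2 * ?Y) ^ 3 / ?D" using X by (intro divide_right_mono power_mono) auto
  also have "?X * ?Y \<le> (2 * ?Y) * ?Y" using X by (intro mult_right_mono) auto
  finally have "?X\<^sup>2 * \<bar>ln ?D - ln ?X + (x \<bullet> y) / ?X\<^sup>2\<bar>
      \<le> 2 * ?Y * (3 * ?Y) + (2 * ?Y) ^ 3 / ?D + 2 * ?Y * ?Y" by simp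
  also have "\<dots> = 8 * ?Y\<^sup>2 + 8 * ?Y ^ 3 / ?D"
    by (simp add: power2_eq_square power3_eq_cube)
  finally show ?thesis using zero_le_power2[of ?Y] by linarith
qed

section \<open>The logarithmic potential and the operator \<open>T\<close>\<close>

locale decaying_potential =
  fixes V :: "R4 \<Rightarrow> real"
  assumes V_meas [measurable]: "V \<in> borel_measurable lebesgue"
    and V_nonzero: "\<not> (AE x in lebesgue. V x = 0)"
    and v_decay: "decays_beyond (v V) 4"
begin

abbreviation vC :: "R4 \<Rightarrow> complex" where "vC x \<equiv> complex_of_real (v V x)"

lemma v_measurable [measurable]: "v V \<in> borel_measurable lebesgue"
  unfolding v_def[abs_def] by measurable

lemma U_measurable [measurable]: "U V \<in> borel_measurable lebesgue"
  unfolding U_def[abs_def] by measurable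

lemma v_nonneg: "0 \<le> v V x" by (simp add: v_def)

lemma id_measurable_lebesgue: "(\<lambda>x. x) \<in> borel_measurable (lebesgue :: R4 measure)"
  by (rule measurable_completion, rule measurable_ident_sets) simp

lemma japanese_measurable_lebesgue [measurable]: "japanese_bracket \<in> borel_measurable lebesgue"
  by (intro measurable_completion) (simp add: japanese_bracket_measurable)

lemma dist_measurable_lebesgue [measurable]: "(\<lambda>y. norm (x - y)) \<in> borel_measurable (lebesgue :: R4 measure)"
  by (intro measurable_completion) measurable

lemma v_bound:
  obtains C s where "0 < C" "0 < s" "\<And>x. v V x \<le> C * japanese_bracket x powr (- 4 - s)"
proof -
  obtain C s where "0 < C" "0 < s" "\<And>x. \<bar>v V x\<bar> \<le> C * japanese_bracket x powr (- 4 - s)"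
    using v_decay unfolding decays_beyond_def by blast
  with that show ?thesis by (simp add: v_nonneg)
qed

lemma weighted_v_bound:
  assumes "v V x \<le> C * japanese_bracket x powr (- 4 - s)" "0 < C"
  shows "(japanese_bracket x ^ j * v V x)\<^sup>2 \<le> C\<^sup>2 * japanese_bracket x powr (2 * real j - 8 - 2 * s)"
proof -
  let ?J = "japanese_bracket x"
  have J: "0 < ?J" by (rule japanese_bracket_pos)
  have "?J ^ j * v V x \<le> ?J ^ j * (C * ?J powr (- 4 - s))"
    using J assms by (intro mult_left_mono) auto
  also have "\<dots> = C * (?J powr real j * ?J powr (- 4 - s))" using J by (simp add: powr_realpow)
  also have "\<dots> = C * ?J powr (real j - 4 - s)" by (simp add: powr_add[symmetric] algebra_simps)
  finally have "(?J ^ j * v V x)\<^sup>2 \<le> (C * ?J powr (real j - 4 - s))\<^sup>2"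
    using J v_nonneg[of x] by (intro power_mono) auto
  also have "\<dots> = C\<^sup>2 * (?J powr (real j - 4 - s) * ?J powr (real j - 4 - s))"
    by (simp add: power2_eq_square)
  also have "\<dots> = C\<^sup>2 * ?J powr (2 * real j - 8 - 2 * s)"
    by (simp add: powr_add[symmetric] algebra_simps)
  finally show ?thesis .
qed

lemma weighted_v_L2:
  assumes j: "j \<le> 2"
  shows "(\<lambda>x. complex_of_real (japanese_bracket x ^ j * v V x)) \<in> L2"
proof -
  obtain C s where Cs: "0 < C" "0 < s" "\<And>x. v V x \<le> C * japanese_bracket x powr (- 4 - s)"
    using v_bound by blast
  show ?thesis
  proof (rule L2_dominated)
    show "integrable lebesgue (\<lambda>x. C\<^sup>2 * japanese_bracket x powr (- (4 + 2 * s)))"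
      using Cs(2) by (intro integrable_mult_right integrable_japanese_bracket) simp
    have "(norm (complex_of_real (japanese_bracket x ^ j * v V x)))\<^sup>2
        \<le> C\<^sup>2 * japanese_bracket x powr (- (4 + 2 * s))" for x
    proof -
      have "(japanese_bracket x ^ j * v V x)\<^sup>2 \<le> C\<^sup>2 * japanese_bracket x powr (2 * real j - 8 - 2 * s)"
        by (rule weighted_v_bound[OF Cs(3,1)])
      also have "\<dots> \<le> C\<^sup>2 * japanese_bracket x powr (- (4 + 2 * s))"
        using j japanese_bracket_ge_1 by (intro mult_left_mono powr_mono) auto
      finally show ?thesis by (simp only: norm_of_real power2_abs)
    qed
    then show "AE x in lebesgue. (norm (complex_of_real (japanese_bracket x ^ j * v V x)))\<^sup>2
        \<le> C\<^sup>2 * japanese_bracket x powr (- (4 + 2 * s))" by simp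
  qed measurable
qed

lemma vC_L2: "vC \<in> L2"
  using weighted_v_L2[of 0] by simp

lemma coordinate_v_L2: "(\<lambda>x. complex_of_real (x $ j) * vC x) \<in> L2"
proof (rule L2_dominated)
  show "integrable lebesgue (\<lambda>x. (norm (complex_of_real (japanese_bracket x ^ 1 * v V x)))\<^sup>2)"
    by (rule L2_square_integrable[OF weighted_v_L2]) simp
  have "(norm (complex_of_real (x $ j) * vC x))\<^sup>2 \<le> (norm (complex_of_real (japanese_bracket x ^ 1 * v V x)))\<^sup>2" for x
  proof (rule power_mono)
    have "\<bar>x $ j\<bar> \<le> japanese_bracket x"
      using component_le_norm_cart norm_le_japanese_bracket order_trans by blast
    then show "norm (complex_of_real (x $ j) * vC x) \<le> norm (complex_of_real (japanese_bracket x ^ 1 * v V x))"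
      using japanese_bracket_pos[of x] by (simp add: norm_mult mult_right_mono)
  qed simp
  then show "AE x in lebesgue. (norm (complex_of_real (x $ j) * vC x))\<^sup>2
      \<le> (norm (complex_of_real (japanese_bracket x ^ 1 * v V x)))\<^sup>2" by simp
  have "(\<lambda>x. x $ j) \<in> borel_measurable (lebesgue :: R4 measure)"
    by (rule measurable_completion) (simp add: cart_eq_inner_axis)
  then show "(\<lambda>x. complex_of_real (x $ j) * vC x) \<in> borel_measurable lebesgue" by measurable
qed

lemma second_moment_integrable:
  assumes f: "f \<in> L2"
  shows "integrable lebesgue (\<lambda>y. (japanese_bracket y)\<^sup>2 * (v V y * norm (f y)))"
proof -
  have "integrable lebesgue (\<lambda>y. norm (complex_of_real ((japanese_bracket y)\<^sup>2 * v V y) * f y))"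
    by (intro integrable_norm L2_mult_integrable weighted_v_L2 f) simp
  moreover have "norm (complex_of_real ((japanese_bracket y)\<^sup>2 * v V y) * f y)
      = (japanese_bracket y)\<^sup>2 * (v V y * norm (f y))" for y
    using v_nonneg[of y] by (simp add: norm_mult norm_power)
  ultimately show ?thesis by simp
qed

text \<open>
  The weight \<open>\<langle>y\<rangle>\<^sup>3\<close> is the one produced by \<open>log_kernel_expansion\<close>. By \<open>a b \<le> a\<^sup>2 + b\<^sup>2\<close> the integrand is
  at most \<open>\<bar>f\<bar>\<^sup>2 + \<langle>y\<rangle>\<^sup>6 v\<^sup>2/\<bar>x - y\<bar>\<^sup>2\<close>, and \<open>\<langle>y\<rangle>\<^sup>6 v\<^sup>2\<close> decays faster than \<open>\<langle>y\<rangle>\<^sup>-\<^sup>2\<close>; this is where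
  decay of \<open>v\<close> beyond order four is used to the full.
\<close>

lemma singular_potential_bound:
  assumes f: "f \<in> L2"
  obtains K where "\<And>x. integrable lebesgue (\<lambda>y. (japanese_bracket y) ^ 3 * (v V y * norm (f y)) / norm (x - y))"
    and "\<And>x. (LINT y|lebesgue. (japanese_bracket y) ^ 3 * (v V y * norm (f y)) / norm (x - y)) \<le> K"
proof -
  obtain C s where Cs: "0 < C" "0 < s" "\<And>x. v V x \<le> C * japanese_bracket x powr (- 4 - s)"
    using v_bound by blast
  let ?k = "\<lambda>x y. japanese_bracket y powr (- (2 + 2 * s)) / (norm (x - y))\<^sup>2"
  have "0 < 2 * s" using Cs by simp
  from inverse_square_kernel_bound[OF this] obtain K where
    K: "\<And>x. integrable lebesgue (?k x)" "\<And>x. integral\<^sup>L lebesgue (?k x) \<le> K" by blast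
  let ?g = "\<lambda>x y. C\<^sup>2 * ?k x y + (norm (f y))\<^sup>2"
  have gi: "integrable lebesgue (?g x)" for x
    by (intro Bochner_Integration.integrable_add integrable_mult_right K(1) L2_square_integrable f)
  have gI: "integral\<^sup>L lebesgue (?g x) \<le> C\<^sup>2 * K + sqnorm f" for x
  proof -
    have "integral\<^sup>L lebesgue (?g x) = C\<^sup>2 * integral\<^sup>L lebesgue (?k x) + sqnorm f"
      using integrable_mult_right[OF K(1)[of x], of "C\<^sup>2"] L2_square_integrable[OF f]
      by (subst Bochner_Integration.integral_add) (simp_all only: sqnorm_def integral_mult_right_zero)
    also have "\<dots> \<le> C\<^sup>2 * K + sqnorm f" using K(2)[of x] by (simp add: mult_left_mono)
    finally show ?thesis .
  qed
  have bound: "norm ((japanese_bracket y) ^ 3 * (v V y * norm (f y)) / norm (x - y)) \<le> ?g x y" for x y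
  proof -
    let ?a = "(japanese_bracket y) ^ 3 * v V y" and ?b = "norm (f y)" and ?d = "norm (x - y)"
    have a0: "0 \<le> ?a" using japanese_bracket_pos[of y] v_nonneg[of y] by simp
    have "(?a / ?d) * ?b \<le> (?a / ?d)\<^sup>2 + ?b\<^sup>2"
    proof -
      have "2 * ((?a / ?d) * ?b) \<le> (?a / ?d)\<^sup>2 + ?b\<^sup>2"
        using sum_squares_bound[of "?a / ?d" ?b] by (simp only: mult.assoc)
      moreover have "0 \<le> (?a / ?d) * ?b" using a0 by simp
      ultimately show ?thesis by linarith
    qed
    also have "(?a / ?d)\<^sup>2 \<le> C\<^sup>2 * ?k x y"
    proof -
      have "?a\<^sup>2 \<le> C\<^sup>2 * japanese_bracket y powr (2 * real 3 - 8 - 2 * s)"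
        by (rule weighted_v_bound[OF Cs(3,1)])
      then have "?a\<^sup>2 / ?d\<^sup>2 \<le> C\<^sup>2 * japanese_bracket y powr (- (2 + 2 * s)) / ?d\<^sup>2"
        by (intro divide_right_mono) simp_all
      then show ?thesis by (simp add: power_divide)
    qed
    finally show ?thesis
      by (simp add: abs_mult mult.assoc power_abs abs_of_nonneg[OF v_nonneg] abs_of_pos[OF japanese_bracket_pos])
  qed
  note [measurable] = L2_measurable[OF f]
  have m: "(\<lambda>y. (japanese_bracket y) ^ 3 * (v V y * norm (f y)) / norm (x - y)) \<in> borel_measurable lebesgue" for x
    by measurable
  show ?thesis
  proof (rule that)
    fix x
    have ae: "AE y in lebesgue. norm ((japanese_bracket y) ^ 3 * (v V y * norm (f y)) / norm (x - y)) \<le> ?g x y"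
      using bound by simp
    show "integrable lebesgue (\<lambda>y. (japanese_bracket y) ^ 3 * (v V y * norm (f y)) / norm (x - y))"
      by (rule integrable_lebesgue_bound(1)[OF gi m ae])
    show "(LINT y|lebesgue. (japanese_bracket y) ^ 3 * (v V y * norm (f y)) / norm (x - y)) \<le> C\<^sup>2 * K + sqnorm f"
      using integrable_lebesgue_bound(2)[OF gi m ae] gI[of x] by simp
  qed
qed

lemma log_kernel_measurable [measurable]:
  "(\<lambda>p. ln (norm (fst p - snd p))) \<in> borel_measurable (lebesgue \<Otimes>\<^sub>M (lebesgue :: R4 measure))"
proof -
  have "fst \<in> borel_measurable ((lebesgue :: R4 measure) \<Otimes>\<^sub>M (lebesgue :: R4 measure))"
    by (rule measurable_compose[OF measurable_fst id_measurable_lebesgue])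
  moreover have "snd \<in> borel_measurable ((lebesgue :: R4 measure) \<Otimes>\<^sub>M (lebesgue :: R4 measure))"
    by (rule measurable_compose[OF measurable_snd id_measurable_lebesgue])
  ultimately show ?thesis by measurable
qed

definition log_potential :: "(R4 \<Rightarrow> complex) \<Rightarrow> R4 \<Rightarrow> complex"
  where "log_potential f x = (LINT y|lebesgue. of_real (ln (norm (x - y))) * (vC y * f y))"

lemma G1_eq_log_potential:
  "G1 (\<lambda>y. vC y * f y) x = - of_real (1 / (8 * pi\<^sup>2)) * log_potential f x"
  unfolding G1_def log_potential_def ..

lemma log_potential_measurable [measurable]:
  assumes f: "f \<in> L2" shows "log_potential f \<in> borel_measurable lebesgue"
proof -
  note [measurable] = L2_measurable[OF f]
  have "(\<lambda>x. vC x * f x) \<in> borel_measurable lebesgue" by measurable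
  from measurable_compose[OF measurable_snd this] 
  have "(\<lambda>p. complex_of_real (ln (norm (fst p - snd p))) * (vC (snd p) * f (snd p)))
      \<in> borel_measurable (lebesgue \<Otimes>\<^sub>M lebesgue)"
    using measurable_compose[OF log_kernel_measurable borel_measurable_of_real] by (intro borel_measurable_times) auto
  then show ?thesis
    unfolding log_potential_def[abs_def]
    by (intro lebesgue_R4.borel_measurable_lebesgue_integral) (simp add: case_prod_unfold)
qed

text \<open>
  Linear growth in \<open>x\<close> is a crude bound for a potential of logarithmic growth, but \<open>\<langle>x\<rangle> v\<close> is square
  integrable, and this is enough for \<open>vG\<^sub>1v\<close> to map \<open>L\<^sup>2\<close> into itself and for Fubini's theorem to apply.
\<close>

lemma log_kernel_bound:
  assumes f: "f \<in> L2"
  obtains K where "0 \<le> K"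
    and "\<And>x. integrable lebesgue (\<lambda>y. \<bar>ln (norm (x - y))\<bar> * (v V y * norm (f y)))"
    and "\<And>x. (LINT y|lebesgue. \<bar>ln (norm (x - y))\<bar> * (v V y * norm (f y))) \<le> K * japanese_bracket x"
proof -
  let ?J = japanese_bracket
  let ?m = "\<lambda>y. (?J y)\<^sup>2 * (v V y * norm (f y))"
  let ?s = "\<lambda>x y. ?J y ^ 3 * (v V y * norm (f y)) / norm (x - y)"
  from singular_potential_bound[OF f] obtain K where
    K: "\<And>x. integrable lebesgue (?s x)" "\<And>x. integral\<^sup>L lebesgue (?s x) \<le> K" by blast
  have mi: "integrable lebesgue ?m" by (rule second_moment_integrable[OF f])
  let ?M = "integral\<^sup>L lebesgue ?m"
  have M0: "0 \<le> ?M" using v_nonneg by (intro integral_nonneg_AE) simp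
  have K0: "0 \<le> K"
    by (rule order_trans[OF _ K(2)[of 0]])
      (use v_nonneg japanese_bracket_pos in \<open>simp add: integral_nonneg_AE less_imp_le\<close>)
  let ?g = "\<lambda>x y. norm x * ?m y + ?m y + ?s x y"
  have gi: "integrable lebesgue (?g x)" for x using mi K(1)[of x] by simp
  have gI: "integral\<^sup>L lebesgue (?g x) \<le> (2 * ?M + K) * ?J x" for x
  proof -
    have "integral\<^sup>L lebesgue (?g x) = norm x * ?M + ?M + integral\<^sup>L lebesgue (?s x)"
      using mi K(1)[of x] by simp
    also have "\<dots> \<le> ?J x * ?M + ?J x * ?M + ?J x * K"
    proof (intro add_mono)
      show "norm x * ?M \<le> ?J x * ?M" using M0 norm_le_japanese_bracket by (intro mult_right_mono)
      show "?M \<le> ?J x * ?M" using mult_right_mono[OF japanese_bracket_ge_1 M0] by simp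
      have "K \<le> ?J x * K" using mult_right_mono[OF japanese_bracket_ge_1 K0] by simp
      with K(2)[of x] show "integral\<^sup>L lebesgue (?s x) \<le> ?J x * K" by linarith
    qed
    finally show ?thesis by (simp add: algebra_simps)
  qed
  have bound: "norm (\<bar>ln (norm (x - y))\<bar> * (v V y * norm (f y))) \<le> ?g x y" for x y
  proof -
    let ?w = "v V y * norm (f y)"
    have w: "0 \<le> ?w" using v_nonneg by simp
    have J: "1 \<le> ?J y" by (rule japanese_bracket_ge_1)
    have J2: "1 \<le> (?J y)\<^sup>2" "?J y \<le> (?J y)\<^sup>2" "1 \<le> ?J y ^ 3"
      using J by (auto intro: one_le_power self_le_power)
    have "\<bar>ln (norm (x - y))\<bar> * ?w \<le> (norm x + norm y + 1 / norm (x - y)) * ?w"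
      using w by (intro mult_right_mono abs_ln_norm_le)
    also have "\<dots> = norm x * (1 * ?w) + norm y * ?w + 1 * ?w / norm (x - y)"
      by (simp add: algebra_simps)
    also have "\<dots> \<le> norm x * ?m y + ?m y + ?s x y"
      using w J2 norm_le_japanese_bracket[of y]
      by (intro add_mono mult_left_mono mult_right_mono divide_right_mono) auto
    finally show ?thesis by (simp only: real_norm_def abs_mult[of "\<bar>_\<bar>"] abs_abs abs_of_nonneg[OF w])
  qed
  note [measurable] = L2_measurable[OF f]
  have m: "(\<lambda>y. \<bar>ln (norm (x - y))\<bar> * (v V y * norm (f y))) \<in> borel_measurable lebesgue" for x
    by measurable
  show ?thesis
  proof (rule that)
    show "0 \<le> 2 * ?M + K" using M0 K0 by simp
    fix x
    have ae: "AE y in lebesgue. norm (\<bar>ln (norm (x - y))\<bar> * (v V y * norm (f y))) \<le> ?g x y"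
      using bound by simp
    show "integrable lebesgue (\<lambda>y. \<bar>ln (norm (x - y))\<bar> * (v V y * norm (f y)))"
      by (rule integrable_lebesgue_bound(1)[OF gi m ae])
    show "(LINT y|lebesgue. \<bar>ln (norm (x - y))\<bar> * (v V y * norm (f y))) \<le> (2 * ?M + K) * ?J x"
      using integrable_lebesgue_bound(2)[OF gi m ae] gI[of x] by simp
  qed
qed

lemma log_integrand_measurable:
  assumes f: "f \<in> L2"
  shows "(\<lambda>y. complex_of_real (ln (norm (x - y))) * (vC y * f y)) \<in> borel_measurable lebesgue"
proof -
  note [measurable] = L2_measurable[OF f]
  show ?thesis by measurable
qed

lemma log_potential_integrable:
  assumes f: "f \<in> L2"
  shows "integrable lebesgue (\<lambda>y. complex_of_real (ln (norm (x - y))) * (vC y * f y))"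
proof -
  from log_kernel_bound[OF f] have
    "integrable lebesgue (\<lambda>y. \<bar>ln (norm (x - y))\<bar> * (v V y * norm (f y)))" by blast
  then show ?thesis
  proof (rule integrable_lebesgue_bound(1))
    show "(\<lambda>y. complex_of_real (ln (norm (x - y))) * (vC y * f y)) \<in> borel_measurable lebesgue"
      by (rule log_integrand_measurable[OF f])
  qed (simp add: norm_mult abs_of_nonneg[OF v_nonneg])
qed

lemma log_potential_bound:
  assumes f: "f \<in> L2"
  obtains K where "0 \<le> K" "\<And>x. norm (log_potential f x) \<le> K * japanese_bracket x"
proof -
  from log_kernel_bound[OF f] obtain K where K: "0 \<le> K"
    "\<And>x. integrable lebesgue (\<lambda>y. \<bar>ln (norm (x - y))\<bar> * (v V y * norm (f y)))"
    "\<And>x. (LINT y|lebesgue. \<bar>ln (norm (x - y))\<bar> * (v V y * norm (f y))) \<le> K * japanese_bracket x" by blast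
  have "norm (log_potential f x) \<le> (LINT y|lebesgue. \<bar>ln (norm (x - y))\<bar> * (v V y * norm (f y)))" for x
    unfolding log_potential_def
    by (rule integrable_lebesgue_bound(2)[OF K(2) log_integrand_measurable[OF f]])
      (simp add: norm_mult abs_of_nonneg[OF v_nonneg])
  with K(3) have "norm (log_potential f x) \<le> K * japanese_bracket x" for x
    using order_trans by blast
  with K(1) show ?thesis by (rule that)
qed

lemma op_T_eq: "op_T V f x = of_real (U V x) * f x - of_real (1 / (8 * pi\<^sup>2)) * (vC x * log_potential f x)"
  unfolding op_T_def G1_eq_log_potential by simp

lemma v_log_potential_L2:
  assumes f: "f \<in> L2" shows "(\<lambda>x. vC x * log_potential f x) \<in> L2"
proof -
  obtain K where K: "0 \<le> K" "\<And>x. norm (log_potential f x) \<le> K * japanese_bracket x"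
    using log_potential_bound[OF f] by blast
  let ?g = "\<lambda>x. complex_of_real K * complex_of_real (japanese_bracket x ^ 1 * v V x)"
  have g: "?g \<in> L2" by (intro L2_cmult weighted_v_L2) simp
  show ?thesis
  proof (rule L2_dominated)
    show "integrable lebesgue (\<lambda>x. (norm (?g x))\<^sup>2)" by (rule L2_square_integrable[OF g])
    have "(norm (vC x * log_potential f x))\<^sup>2 \<le> (norm (?g x))\<^sup>2" for x
    proof (rule power_mono)
      have "v V x * norm (log_potential f x) \<le> v V x * (K * japanese_bracket x)"
        using v_nonneg K(2) by (intro mult_left_mono)
      then show "norm (vC x * log_potential f x) \<le> norm (?g x)"
        using v_nonneg[of x] K(1) japanese_bracket_pos[of x] by (simp add: norm_mult abs_mult ac_simps)
    qed simp
    then show "AE x in lebesgue. (norm (vC x * log_potential f x))\<^sup>2 \<le> (norm (?g x))\<^sup>2" by simp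
    show "(\<lambda>x. vC x * log_potential f x) \<in> borel_measurable lebesgue"
      using log_potential_measurable[OF f] by measurable
  qed
qed

lemma U_mult_L2:
  assumes f: "f \<in> L2" shows "(\<lambda>x. of_real (U V x) * f x) \<in> L2"
proof (rule L2_dominated)
  show "integrable lebesgue (\<lambda>x. (norm (f x))\<^sup>2)" by (rule L2_square_integrable[OF f])
  show "(\<lambda>x. of_real (U V x) * f x) \<in> borel_measurable lebesgue" using f by measurable
  show "AE x in lebesgue. (norm (of_real (U V x) * f x))\<^sup>2 \<le> (norm (f x))\<^sup>2"
    by (simp add: norm_mult U_def)
qed

lemma op_T_L2: "f \<in> L2 \<Longrightarrow> op_T V f \<in> L2"
  unfolding op_T_eq[abs_def] by (intro L2_diff U_mult_L2 L2_cmult v_log_potential_L2)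

lemma log_potential_cong: "ae_eq f g \<Longrightarrow> log_potential f = log_potential g"
  unfolding log_potential_def[abs_def] by (intro ext integral_ae_eq ae_eq_mult ae_eq_refl)

lemma op_T_cong: "ae_eq f g \<Longrightarrow> ae_eq (op_T V f) (op_T V g)"
  unfolding op_T_eq[abs_def] using log_potential_cong[of f g]
  by (simp add: ae_eq_diff ae_eq_mult ae_eq_refl)

lemma op_T_cmult: "op_T V (\<lambda>x. c * f x) = (\<lambda>x. c * op_T V f x)"
proof -
  have "log_potential (\<lambda>x. c * f x) x = c * log_potential f x" for x
    unfolding log_potential_def by (subst integral_mult_right_zero[symmetric]) (simp add: ac_simps)
  then show ?thesis unfolding op_T_eq[abs_def] by (simp add: algebra_simps)
qed

text \<open>
  Fubini's theorem for the symmetric kernel \<open>log \<bar>x - y\<bar>\<close>; with \<open>log_potential_cnj\<close> it makes \<open>T\<close>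
  self-adjoint.
\<close>

lemma log_form_sym:
  assumes f: "f \<in> L2" and g: "g \<in> L2"
  shows "(LINT x|lebesgue. (vC x * g x) * log_potential f x)
       = (LINT y|lebesgue. (vC y * f y) * log_potential g y)"
proof -
  let ?F = "\<lambda>(x, y). (vC x * g x) * (complex_of_real (ln (norm (x - y))) * (vC y * f y))"
  note [measurable] = L2_measurable[OF f] L2_measurable[OF g]
  have vf: "(\<lambda>x. vC x * f x) \<in> borel_measurable lebesgue" and vg: "(\<lambda>x. vC x * g x) \<in> borel_measurable lebesgue"
    by measurable
  have Fm: "?F \<in> borel_measurable (lebesgue \<Otimes>\<^sub>M lebesgue)"
    using measurable_compose[OF measurable_snd vf] measurable_compose[OF measurable_fst vg]
      measurable_compose[OF log_kernel_measurable borel_measurable_of_real]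
    unfolding case_prod_unfold by (intro borel_measurable_times) auto
  from log_kernel_bound[OF f] obtain K where K: "0 \<le> K"
    "\<And>x. integrable lebesgue (\<lambda>y. \<bar>ln (norm (x - y))\<bar> * (v V y * norm (f y)))"
    "\<And>x. (LINT y|lebesgue. \<bar>ln (norm (x - y))\<bar> * (v V y * norm (f y))) \<le> K * japanese_bracket x" by blast
  let ?I = "\<lambda>x. LINT y|lebesgue. \<bar>ln (norm (x - y))\<bar> * (v V y * norm (f y))"
  have inner: "(LINT y|lebesgue. norm (?F (x, y))) = v V x * norm (g x) * ?I x" for x
    using v_nonneg by (simp add: norm_mult ac_simps flip: integral_mult_right_zero)
  have "integrable lebesgue (\<lambda>x. LINT y|lebesgue. norm (?F (x, y)))"
  proof (rule integrable_lebesgue_bound(1))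
    show "integrable lebesgue (\<lambda>x. K * ((japanese_bracket x)\<^sup>2 * (v V x * norm (g x))))"
      by (intro integrable_mult_right second_moment_integrable g)
    show "(\<lambda>x. LINT y|lebesgue. norm (?F (x, y))) \<in> borel_measurable lebesgue"
      using measurable_compose[OF Fm borel_measurable_norm]
      by (intro lebesgue_R4.borel_measurable_lebesgue_integral) (simp add: case_prod_unfold)
    have "norm (LINT y|lebesgue. norm (?F (x, y))) \<le> K * ((japanese_bracket x)\<^sup>2 * (v V x * norm (g x)))" for x
    proof -
      let ?w = "v V x * norm (g x)"
      have w: "0 \<le> ?w" using v_nonneg by simp
      have I0: "0 \<le> ?I x" using v_nonneg by (intro integral_nonneg_AE) simp
      have "?w * ?I x \<le> ?w * (K * japanese_bracket x)" using w K(3) by (intro mult_left_mono)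
      also have "\<dots> \<le> ?w * (K * (japanese_bracket x)\<^sup>2)"
        using w K(1) japanese_bracket_ge_1[of x] by (intro mult_left_mono self_le_power) auto
      finally show ?thesis unfolding inner using I0
        by (simp add: abs_mult ac_simps abs_of_nonneg[OF v_nonneg])
    qed
    then show "AE x in lebesgue. norm (LINT y|lebesgue. norm (?F (x, y)))
        \<le> K * ((japanese_bracket x)\<^sup>2 * (v V x * norm (g x)))" by simp
  qed
  moreover have "AE x in lebesgue. integrable lebesgue (\<lambda>y. ?F (x, y))"
    by (simp add: log_potential_integrable[OF f])
  ultimately have Fi: "integrable (lebesgue \<Otimes>\<^sub>M lebesgue) ?F"
    by (rule lebesgue_R4_pair.Fubini_integrable[OF Fm])
  have "(LINT x|lebesgue. (vC x * g x) * log_potential f x) = (LINT x|lebesgue. LINT y|lebesgue. ?F (x, y))"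
    unfolding log_potential_def by simp
  also have "\<dots> = (LINT y|lebesgue. LINT x|lebesgue. ?F (x, y))"
    using lebesgue_R4_pair.Fubini_integral[of "\<lambda>x y. ?F (x, y)"] Fi by simp
  also have "\<dots> = (LINT y|lebesgue. (vC y * f y) * log_potential g y)"
    unfolding log_potential_def
    by (simp add: norm_minus_commute ac_simps flip: integral_mult_right_zero)
  finally show ?thesis .
qed

lemma log_potential_cnj: "log_potential (\<lambda>x. cnj (f x)) x = cnj (log_potential f x)"
  unfolding log_potential_def by (subst Bochner_Integration.integral_cnj[symmetric]) simp

lemma op_T_self_adjoint:
  assumes f: "f \<in> L2" and h: "h \<in> L2"
  shows "L2_inner (op_T V f) h = L2_inner f (op_T V h)"
proof -
  let ?c = "complex_of_real (1 / (8 * pi\<^sup>2))"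
  let ?u = "\<lambda>x. complex_of_real (U V x) * f x"
  let ?u' = "\<lambda>x. complex_of_real (U V x) * h x"
  let ?p = "\<lambda>x. vC x * log_potential f x" and ?q = "\<lambda>x. vC x * log_potential h x"
  have L: "?u \<in> L2" "?u' \<in> L2" "(\<lambda>x. ?c * ?p x) \<in> L2" "(\<lambda>x. ?c * ?q x) \<in> L2"
    by (intro U_mult_L2 f h L2_cmult v_log_potential_L2)+
  have "L2_inner (op_T V f) h = L2_inner ?u h - ?c * L2_inner ?p h"
    unfolding op_T_eq[abs_def] L2_inner_diff_left[OF L(1,3) h] L2_inner_cmult_left ..
  moreover have "L2_inner (op_T V h) f = L2_inner ?u' f - ?c * L2_inner ?q f"
    unfolding op_T_eq[abs_def] L2_inner_diff_left[OF L(2,4) f] L2_inner_cmult_left ..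
  moreover have "L2_inner ?u h = cnj (L2_inner ?u' f)"
    unfolding L2_inner_def by (subst Bochner_Integration.integral_cnj[symmetric]) (simp add: ac_simps)
  moreover have "L2_inner ?p h = cnj (L2_inner ?q f)"
  proof -
    have "L2_inner ?p h = (LINT x|lebesgue. (vC x * cnj (h x)) * log_potential f x)"
      unfolding L2_inner_def by (simp add: ac_simps)
    also have "\<dots> = (LINT x|lebesgue. (vC x * f x) * log_potential (\<lambda>x. cnj (h x)) x)"
      by (rule log_form_sym[OF f L2_cnj[OF h]])
    also have "\<dots> = cnj (L2_inner ?q f)"
      unfolding L2_inner_def log_potential_cnj
      by (subst Bochner_Integration.integral_cnj[symmetric]) (simp add: ac_simps)
    finally show ?thesis .
  qed
  ultimately have "L2_inner (op_T V f) h = cnj (L2_inner (op_T V h) f)" by simp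
  then show ?thesis by (simp only: L2_inner_cnj)
qed

section \<open>The ranges of \<open>S\<^sub>1\<close>, \<open>S\<^sub>2\<close> and \<open>S\<^sub>3\<close>\<close>

lemma norm_vC: "(norm (vC x))\<^sup>2 = \<bar>V x\<bar>"
  by (simp add: v_def)

lemma sqnorm_vC: "sqnorm vC = (LINT x|lebesgue. \<bar>V x\<bar>)"
  unfolding sqnorm_def norm_vC ..

lemma sqnorm_vC_pos: "0 < sqnorm vC"
proof -
  have "sqnorm vC \<noteq> 0"
  proof
    assume "sqnorm vC = 0"
    then have "ae_eq vC (\<lambda>x. 0)" by (simp add: sqnorm_eq_0_iff[OF vC_L2])
    then have "AE x in lebesgue. V x = 0" unfolding ae_eq_def by eventually_elim (simp add: v_def)
    with V_nonzero show False ..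
  qed
  with sqnorm_nonneg[of vC] show ?thesis by simp
qed

definition v_coeff :: "(R4 \<Rightarrow> complex) \<Rightarrow> complex"
  where "v_coeff f = L2_inner f vC / of_real (sqnorm vC)"

lemma v_coeff_eq_0_iff: "v_coeff f = 0 \<longleftrightarrow> L2_inner f vC = 0"
  using sqnorm_vC_pos by (simp add: v_coeff_def)

lemma v_coeff_residual:
  assumes f: "f \<in> L2" shows "L2_inner (\<lambda>x. f x - v_coeff f * vC x) vC = 0"
  using sqnorm_vC_pos unfolding L2_inner_diff_left[OF f L2_cmult[OF vC_L2] vC_L2] L2_inner_cmult_left
  by (simp add: L2_inner_self v_coeff_def)

lemma op_P_ae:
  assumes f: "f \<in> L2" shows "ae_eq (op_P V f) (\<lambda>x. v_coeff f * vC x)"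
  unfolding op_P_def
proof (rule orth_proj_unique)
  show "span_v V \<subseteq> L2" by (auto simp: span_v_def)
  show "(\<lambda>x. a x - b x) \<in> span_v V" if ab: "a \<in> span_v V" "b \<in> span_v V" for a b
  proof -
    obtain c d where "ae_eq a (\<lambda>x. c * vC x)" "ae_eq b (\<lambda>x. d * vC x)"
      using ab by (auto simp: span_v_def)
    from ae_eq_diff[OF this] have "ae_eq (\<lambda>x. a x - b x) (\<lambda>x. (c - d) * vC x)"
      by (simp add: algebra_simps)
    moreover have "(\<lambda>x. a x - b x) \<in> L2" using ab by (intro L2_diff) (auto simp: span_v_def)
    ultimately show ?thesis unfolding span_v_def by blast
  qed
  show "(\<lambda>x. v_coeff f * vC x) \<in> span_v V"
    unfolding span_v_def using L2_cmult[OF vC_L2] ae_eq_refl by blast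
  show "L2_inner (\<lambda>x. f x - v_coeff f * vC x) h = 0" if h: "h \<in> span_v V" for h
  proof -
    obtain d where "ae_eq h (\<lambda>x. d * vC x)" using h by (auto simp: span_v_def)
    then have "L2_inner h (\<lambda>x. f x - v_coeff f * vC x) = L2_inner (\<lambda>x. d * vC x) (\<lambda>x. f x - v_coeff f * vC x)"
      by (rule L2_inner_cong[OF _ ae_eq_refl])
    also have "\<dots> = 0"
      using v_coeff_residual[OF f] unfolding L2_inner_cmult_left L2_inner_eq_0_sym[of _ vC] by simp
    finally show ?thesis by (simp only: L2_inner_eq_0_sym[of h])
  qed
qed (rule f)

lemma op_P_L2:
  assumes f: "f \<in> L2" shows "op_P V f \<in> L2"
  by (rule L2_ae_eq[OF L2_cmult[OF vC_L2] ae_eq_sym[OF op_P_ae[OF f]]])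

lemma op_Q_ae:
  assumes f: "f \<in> L2" shows "ae_eq (op_Q V f) (\<lambda>x. f x - v_coeff f * vC x)"
  unfolding op_Q_def[abs_def] by (rule ae_eq_diff[OF ae_eq_refl op_P_ae[OF f]])

lemma op_Q_L2: "f \<in> L2 \<Longrightarrow> op_Q V f \<in> L2"
  unfolding op_Q_def[abs_def] by (intro L2_diff op_P_L2)

lemma op_Q_perp:
  assumes f: "f \<in> L2" shows "op_Q V f \<in> perp {vC}"
  using op_Q_L2[OF f] v_coeff_residual[OF f] L2_inner_cong[OF op_Q_ae[OF f] ae_eq_refl, of vC]
  by (simp add: perp_def)

lemma op_Q_id:
  assumes f: "f \<in> perp {vC}" shows "ae_eq (op_Q V f) f"
  using op_Q_ae[OF perp_L2[OF f]] f by (simp add: perp_def v_coeff_def)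

lemma op_P_cong: "ae_eq f g \<Longrightarrow> op_P V f = op_P V g"
  unfolding op_P_def by (rule orth_proj_cong)

lemma op_Q_cong: "ae_eq f g \<Longrightarrow> ae_eq (op_Q V f) (op_Q V g)"
  unfolding op_Q_def[abs_def] using op_P_cong[of f g] by (simp add: ae_eq_diff ae_eq_refl)

lemma L2_range_Q: "L2_range (op_Q V) = perp {vC}"
proof (intro subset_antisym subsetI)
  fix f assume "f \<in> L2_range (op_Q V)"
  then obtain g where "g \<in> L2" "ae_eq f (op_Q V g)" by (auto simp: L2_range_def)
  then show "f \<in> perp {vC}" using perp_ae_eq[OF op_Q_perp ae_eq_sym] by blast
next
  fix f assume f: "f \<in> perp {vC}"
  then show "f \<in> L2_range (op_Q V)"
    unfolding L2_range_def using perp_L2[OF f] ae_eq_sym[OF op_Q_id[OF f]] by auto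
qed

definition S1_constraints :: "(R4 \<Rightarrow> complex) set"
  where "S1_constraints = insert vC (op_T V ` perp {vC})"

definition S2_constraints :: "(R4 \<Rightarrow> complex) set"
  where "S2_constraints = insert (op_T V vC) S1_constraints"

definition S3_constraints :: "(R4 \<Rightarrow> complex) set"
  where "S3_constraints = range (\<lambda>j x. of_real (x $ j) * vC x) \<union> S2_constraints"

lemma constraints_L2: "S1_constraints \<subseteq> L2" "S2_constraints \<subseteq> L2" "S3_constraints \<subseteq> L2"
  using vC_L2 op_T_L2 perp_L2 coordinate_v_L2
  by (auto simp: S1_constraints_def S2_constraints_def S3_constraints_def)

text \<open>
  Orthogonality of \<open>f\<close> to \<open>T h\<close> for all \<open>h\<close> orthogonal to \<open>v\<close> says that \<open>T f\<close> is orthogonal to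
  \<open>{v}\<^sup>\<bottom>\<close>; testing with the residual of \<open>T f\<close> after projection to the span of \<open>v\<close> shows that \<open>T f\<close> is a
  multiple of \<open>v\<close>.
\<close>

lemma mem_S1_iff:
  "f \<in> perp S1_constraints \<longleftrightarrow> f \<in> perp {vC} \<and> ae_eq (op_T V f) (\<lambda>x. v_coeff (op_T V f) * vC x)"
proof
  assume l: "f \<in> perp S1_constraints"
  then have f: "f \<in> perp {vC}" by (auto simp: perp_def S1_constraints_def)
  then have fL: "f \<in> L2" by (rule perp_L2)
  note T = op_T_L2[OF fL]
  let ?q = "\<lambda>x. op_T V f x - v_coeff (op_T V f) * vC x"
  have qL: "?q \<in> L2" by (intro L2_diff T L2_cmult vC_L2)
  have q: "?q \<in> perp {vC}" using qL v_coeff_residual[OF T] by (simp add: perp_def)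
  have "L2_inner ?q ?q = L2_inner (op_T V f) ?q - v_coeff (op_T V f) * L2_inner vC ?q"
    by (simp only: L2_inner_diff_left[OF T L2_cmult[OF vC_L2] qL] L2_inner_cmult_left)
  also have "L2_inner vC ?q = 0" using v_coeff_residual[OF T] by (simp only: L2_inner_eq_0_sym[of vC])
  also have "L2_inner (op_T V f) ?q = L2_inner f (op_T V ?q)" by (rule op_T_self_adjoint[OF fL qL])
  also have "\<dots> = 0" using l q by (simp add: perp_def S1_constraints_def)
  finally have "ae_eq ?q (\<lambda>x. 0)" by (simp add: L2_inner_self_eq_0_iff[OF qL])
  then have "ae_eq (op_T V f) (\<lambda>x. v_coeff (op_T V f) * vC x)"
    unfolding ae_eq_def by eventually_elim simp
  with f show "f \<in> perp {vC} \<and> ae_eq (op_T V f) (\<lambda>x. v_coeff (op_T V f) * vC x)" ..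
next
  assume r: "f \<in> perp {vC} \<and> ae_eq (op_T V f) (\<lambda>x. v_coeff (op_T V f) * vC x)"
  then have fL: "f \<in> L2" by (simp add: perp_def)
  have "L2_inner f (op_T V h) = 0" if h: "h \<in> perp {vC}" for h
  proof -
    have hL: "h \<in> L2" using h by (rule perp_L2)
    have "L2_inner f (op_T V h) = L2_inner (op_T V f) h" by (rule op_T_self_adjoint[OF fL hL, symmetric])
    also have "\<dots> = L2_inner (\<lambda>x. v_coeff (op_T V f) * vC x) h" using r by (intro L2_inner_cong ae_eq_refl) simp
    also have "\<dots> = 0" using h by (simp add: L2_inner_cmult_left perp_def L2_inner_eq_0_sym[of vC])
    finally show ?thesis .
  qed
  then show "f \<in> perp S1_constraints" using r by (auto simp: perp_def S1_constraints_def)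
qed

lemma kernel_QTQ: "kernel_on (L2_range (op_Q V)) (op_Q V \<circ> op_T V \<circ> op_Q V) = perp S1_constraints"
proof -
  have "ae_eq (op_Q V (op_T V (op_Q V f))) (\<lambda>x. 0)
      \<longleftrightarrow> ae_eq (op_T V f) (\<lambda>x. v_coeff (op_T V f) * vC x)" if f: "f \<in> perp {vC}" for f
  proof -
    have T: "op_T V f \<in> L2" by (rule op_T_L2[OF perp_L2[OF f]])
    have "ae_eq (op_Q V (op_T V (op_Q V f))) (op_Q V (op_T V f))"
      by (intro op_Q_cong op_T_cong op_Q_id f)
    from ae_eq_trans[OF this op_Q_ae[OF T]]
    have eq: "ae_eq (op_Q V (op_T V (op_Q V f))) (\<lambda>x. op_T V f x - v_coeff (op_T V f) * vC x)" .
    show ?thesis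
    proof
      assume "ae_eq (op_Q V (op_T V (op_Q V f))) (\<lambda>x. 0)"
      from ae_eq_trans[OF ae_eq_sym[OF eq] this]
      show "ae_eq (op_T V f) (\<lambda>x. v_coeff (op_T V f) * vC x)"
        unfolding ae_eq_def by eventually_elim simp
    next
      assume "ae_eq (op_T V f) (\<lambda>x. v_coeff (op_T V f) * vC x)"
      then have "ae_eq (\<lambda>x. op_T V f x - v_coeff (op_T V f) * vC x) (\<lambda>x. 0)"
        unfolding ae_eq_def by eventually_elim simp
      from ae_eq_trans[OF eq this] show "ae_eq (op_Q V (op_T V (op_Q V f))) (\<lambda>x. 0)" .
    qed
  qed
  then show ?thesis
    unfolding kernel_on_def L2_range_Q by (auto simp: mem_S1_iff)
qed

lemma S1_eq: "op_S1 V = orth_proj (perp S1_constraints)"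
  unfolding op_S1_def kernel_QTQ ..

lemma L2_range_S1: "L2_range (op_S1 V) = perp S1_constraints"
  unfolding S1_eq by (rule L2_range_orth_proj_perp[OF constraints_L2(1)])

lemma mem_S2_iff:
  "f \<in> perp S2_constraints \<longleftrightarrow> f \<in> perp S1_constraints \<and> v_coeff (op_T V f) = 0"
proof -
  have "L2_inner f (op_T V vC) = L2_inner (op_T V f) vC" if "f \<in> L2"
    using op_T_self_adjoint[OF that vC_L2] by simp
  then show ?thesis
    unfolding v_coeff_eq_0_iff by (auto simp: perp_def S2_constraints_def)
qed

text \<open>
  On the range of \<open>S\<^sub>1\<close> the operator acts as \<open>f \<mapsto> c S\<^sub>1 T v\<close> with \<open>c = v_coeff (T f)\<close>. If this
  vanishes, pairing with \<open>f\<close> gives \<open>0 = c \<langle>T v, f\<rangle> = c \<langle>v, T f\<rangle>\<close>, and the last factor is the conjugate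
  of \<open>c \<parallel>v\<parallel>\<^sup>2\<close>.
\<close>

lemma kernel_S1TPTS1:
  "kernel_on (L2_range (op_S1 V)) (op_S1 V \<circ> op_T V \<circ> op_P V \<circ> op_T V \<circ> op_S1 V)
    = perp S2_constraints"
proof -
  have "ae_eq (op_S1 V (op_T V (op_P V (op_T V (op_S1 V f))))) (\<lambda>x. 0) \<longleftrightarrow> v_coeff (op_T V f) = 0"
    if f: "f \<in> perp S1_constraints" for f
  proof -
    let ?c = "v_coeff (op_T V f)"
    have fL: "f \<in> L2" by (rule perp_L2[OF f])
    have T: "op_T V f \<in> L2" by (rule op_T_L2[OF fL])
    have "ae_eq (op_T V (op_S1 V f)) (op_T V f)"
      unfolding S1_eq by (intro op_T_cong orth_proj_perp_id constraints_L2 f)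
    then have P: "ae_eq (op_P V (op_T V (op_S1 V f))) (\<lambda>x. ?c * vC x)"
      using op_P_ae[OF T] by (simp only: op_P_cong)
    have "ae_eq (op_T V (op_P V (op_T V (op_S1 V f)))) (\<lambda>x. ?c * op_T V vC x)"
      using op_T_cong[OF P] by (simp only: op_T_cmult)
    then have "op_S1 V (op_T V (op_P V (op_T V (op_S1 V f)))) = op_S1 V (\<lambda>x. ?c * op_T V vC x)"
      unfolding S1_eq by (rule orth_proj_cong)
    moreover have "ae_eq (op_S1 V (\<lambda>x. ?c * op_T V vC x)) (\<lambda>x. 0)
        \<longleftrightarrow> (\<forall>h\<in>perp S1_constraints. ?c * L2_inner (op_T V vC) h = 0)"
      unfolding S1_eq orth_proj_perp_eq_0_iff[OF constraints_L2(1) L2_cmult[OF op_T_L2[OF vC_L2]]]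
        L2_inner_cmult_left ..
    moreover have "(\<forall>h\<in>perp S1_constraints. ?c * L2_inner (op_T V vC) h = 0) \<longleftrightarrow> ?c = 0"
    proof
      assume "\<forall>h\<in>perp S1_constraints. ?c * L2_inner (op_T V vC) h = 0"
      with f have "?c = 0 \<or> L2_inner (op_T V vC) f = 0" by auto
      moreover have "L2_inner (op_T V vC) f = cnj (L2_inner (op_T V f) vC)"
        by (simp add: op_T_self_adjoint[OF vC_L2 fL] L2_inner_cnj)
      ultimately show "?c = 0" by (auto simp: v_coeff_eq_0_iff)
    qed simp
    ultimately show ?thesis by simp
  qed
  then show ?thesis
    unfolding kernel_on_def L2_range_S1 by (auto simp: mem_S2_iff)
qed

lemma S2_eq: "op_S2 V = orth_proj (perp S2_constraints)"
  unfolding op_S2_def kernel_S1TPTS1 ..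

lemma L2_range_S2: "L2_range (op_S2 V) = perp S2_constraints"
  unfolding S2_eq by (rule L2_range_orth_proj_perp[OF constraints_L2(2)])

definition v_moment :: "(R4 \<Rightarrow> complex) \<Rightarrow> 4 \<Rightarrow> complex"
  where "v_moment f j = L2_inner f (\<lambda>x. of_real (x $ j) * vC x)"

text \<open>
  Of \<open>\<bar>x - y\<bar>\<^sup>2 = \<bar>x\<bar>\<^sup>2 + \<bar>y\<bar>\<^sup>2 - 2 x\<cdot>y\<close>, the term \<open>\<bar>y\<bar>\<^sup>2\<close> disappears in the inner integral because \<open>f\<close>
  is orthogonal to \<open>v\<close>, and \<open>\<bar>x\<bar>\<^sup>2\<close> disappears in the outer one because \<open>g\<close> is. What remains exhibits
  the form as the inner product with an element of \<open>L\<^sup>2\<close>, so the operator of the form exists.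
\<close>

lemma vG2v_form_eq:
  assumes f: "f \<in> L2" "L2_inner f vC = 0" and g: "g \<in> L2" "L2_inner g vC = 0"
  shows "vG2v_form V f g = L2_inner (\<lambda>x. \<Sum>j\<in>UNIV. - 2 * v_moment f j * (of_real (x $ j) * vC x)) g"
proof -
  let ?x = "\<lambda>x j. complex_of_real (x $ j)"
  let ?q = "LINT x|lebesgue. f x * complex_of_real ((norm x)\<^sup>2 * v V x)"
  have sq: "(\<lambda>x. complex_of_real ((norm x)\<^sup>2 * v V x)) \<in> L2"
  proof (rule L2_dominated)
    show "integrable lebesgue (\<lambda>x. (norm (complex_of_real (japanese_bracket x ^ 2 * v V x)))\<^sup>2)"
      by (rule L2_square_integrable[OF weighted_v_L2]) simp
    have "(norm x)\<^sup>2 * v V x \<le> japanese_bracket x ^ 2 * v V x" for x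
      by (intro mult_right_mono power_mono norm_le_japanese_bracket v_nonneg) simp
    then have "(norm (complex_of_real ((norm x)\<^sup>2 * v V x)))\<^sup>2
        \<le> (norm (complex_of_real (japanese_bracket x ^ 2 * v V x)))\<^sup>2" for x
      using v_nonneg[of x] by (intro power_mono) (simp_all only: norm_of_real, simp_all)
    then show "AE x in lebesgue. (norm (complex_of_real ((norm x)\<^sup>2 * v V x)))\<^sup>2
        \<le> (norm (complex_of_real (japanese_bracket x ^ 2 * v V x)))\<^sup>2" by simp
    have "norm \<in> borel_measurable (lebesgue :: R4 measure)" by (rule measurable_completion) simp
    then show "(\<lambda>x. complex_of_real ((norm x)\<^sup>2 * v V x)) \<in> borel_measurable lebesgue" by measurable
  qed
  have cross: "(norm (x - y))\<^sup>2 = (norm x)\<^sup>2 + (norm y)\<^sup>2 - 2 * (\<Sum>j\<in>UNIV. x $ j * y $ j)" for x y :: R4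
    by (simp add: power2_norm_eq_inner inner_diff inner_commute[of y x] inner_vec_def[of x y])
  have fv: "integrable lebesgue (\<lambda>x. f x * vC x)" by (rule L2_mult_integrable[OF f(1) vC_L2])
  have fq: "integrable lebesgue (\<lambda>x. f x * complex_of_real ((norm x)\<^sup>2 * v V x))"
    by (rule L2_mult_integrable[OF f(1) sq])
  have fx: "integrable lebesgue (\<lambda>x. f x * (?x x j * vC x))" for j
    by (rule L2_mult_integrable[OF f(1) coordinate_v_L2])
  have m: "(LINT x|lebesgue. f x * (?x x j * vC x)) = v_moment f j" for j
    by (simp add: v_moment_def L2_inner_def)
  have f0: "(LINT x|lebesgue. f x * vC x) = 0" using f(2) by (simp add: L2_inner_def)
  have inner: "(LINT x|lebesgue. vC x * f x * of_real ((norm (x - y))\<^sup>2) * vC y * cnj (g y))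
      = ?q * (vC y * cnj (g y)) + (\<Sum>j\<in>UNIV. - 2 * v_moment f j * (?x y j * vC y)) * cnj (g y)" for y
  proof -
    let ?S = "\<lambda>x. f x * complex_of_real ((norm x)\<^sup>2 * v V x) + of_real ((norm y)\<^sup>2) * (f x * vC x)
        + (\<Sum>j\<in>UNIV. - 2 * ?x y j * (f x * (?x x j * vC x)))"
    have "vC x * f x * of_real ((norm (x - y))\<^sup>2) * vC y * cnj (g y) = ?S x * (vC y * cnj (g y))" for x
      unfolding cross by (simp add: algebra_simps sum_distrib_left sum_distrib_right sum_negf)
    then have "(LINT x|lebesgue. vC x * f x * of_real ((norm (x - y))\<^sup>2) * vC y * cnj (g y))
      = integral\<^sup>L lebesgue ?S * (vC y * cnj (g y))" by (simp only: integral_mult_left_zero)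
    also have "integral\<^sup>L lebesgue ?S = ?q + of_real ((norm y)\<^sup>2) * (LINT x|lebesgue. f x * vC x)
        + (\<Sum>j\<in>UNIV. - 2 * ?x y j * v_moment f j)"
      by (simp only: Bochner_Integration.integral_add Bochner_Integration.integral_sum
          Bochner_Integration.integrable_add Bochner_Integration.integrable_sum
          integral_mult_right_zero integrable_mult_right fv fq fx m)
    finally show ?thesis
      unfolding f0 by (simp add: algebra_simps sum_distrib_left sum_distrib_right)
  qed
  let ?w = "\<lambda>x. \<Sum>j\<in>UNIV. - 2 * v_moment f j * (?x x j * vC x)"
  have wg: "integrable lebesgue (\<lambda>y. ?w y * cnj (g y))"
    unfolding sum_distrib_right mult.assoc[of "- 2 * v_moment f _"]
    by (intro Bochner_Integration.integrable_sum integrable_mult_right L2_inner_integrable coordinate_v_L2 g(1))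
  have vg: "integrable lebesgue (\<lambda>y. vC y * cnj (g y))" by (rule L2_inner_integrable[OF vC_L2 g(1)])
  have "vG2v_form V f g = ?q * L2_inner vC g + L2_inner ?w g"
    unfolding vG2v_form_def inner L2_inner_def
    by (simp only: Bochner_Integration.integral_add integral_mult_right_zero integrable_mult_right wg vg)
  also have "L2_inner vC g = 0" using g(2) by (simp add: L2_inner_eq_0_sym[of vC])
  finally show ?thesis by simp
qed

lemma mem_S3_iff:
  "f \<in> perp S3_constraints \<longleftrightarrow> f \<in> perp S2_constraints \<and> (\<forall>j. v_moment f j = 0)"
  by (auto simp: perp_def S3_constraints_def v_moment_def)

lemma vC_orth_S2: "f \<in> perp S2_constraints \<Longrightarrow> L2_inner f vC = 0"
  by (auto simp: perp_def S2_constraints_def S1_constraints_def)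

text \<open>
  On the diagonal the form equals \<open>- 2 \<Sum>\<^sub>j \<bar>v_moment f j\<bar>\<^sup>2\<close>.
\<close>

lemma kernel_S2vG2vS2:
  "kernel_on (L2_range (op_S2 V)) (form_operator (L2_range (op_S2 V)) (vG2v_form V)) = perp S3_constraints"
proof -
  let ?M = "perp S2_constraints"
  have "ae_eq (form_operator ?M (vG2v_form V) f) (\<lambda>x. 0) \<longleftrightarrow> (\<forall>j. v_moment f j = 0)"
    if f: "f \<in> ?M" for f
  proof -
    let ?w = "\<lambda>x. \<Sum>j\<in>UNIV. - 2 * v_moment f j * (of_real (x $ j) * vC x)"
    let ?h = "form_operator ?M (vG2v_form V) f"
    have fL: "f \<in> L2" by (rule perp_L2[OF f])
    have wL: "?w \<in> L2"
    proof -
      have "(\<lambda>x. \<Sum>j\<in>J. - 2 * v_moment f j * (of_real (x $ j) * vC x)) \<in> L2" if "finite J" for J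
        using that
      proof induction
        case empty
        show ?case by (simp add: L2_zero)
      next
        case (insert i J)
        show ?case
          unfolding sum.insert[OF insert.hyps]
          by (rule L2_add[OF L2_cmult[OF coordinate_v_L2] insert.IH])
      qed
      then show ?thesis by simp
    qed
    have form: "vG2v_form V f g = L2_inner ?w g" if g: "g \<in> ?M" for g
      by (rule vG2v_form_eq[OF fL vC_orth_S2[OF f] perp_L2[OF g] vC_orth_S2[OF g]])
    let ?p = "orth_proj ?M ?w"
    have p: "?p \<in> ?M" by (rule orth_proj_perp(1)[OF constraints_L2(2) wL])
    have "L2_inner ?p g = vG2v_form V f g" if g: "g \<in> ?M" for g
    proof -
      have "L2_inner ?w g - L2_inner ?p g = 0"
        using orth_proj_perp(2)[OF constraints_L2(2) wL g]
        unfolding L2_inner_diff_left[OF wL perp_L2[OF p] perp_L2[OF g]] .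
      then show ?thesis by (simp add: form[OF g])
    qed
    then have "\<exists>h. h \<in> ?M \<and> (\<forall>g\<in>?M. L2_inner h g = vG2v_form V f g)" using p by (intro exI[of _ ?p]) simp
    from someI_ex[OF this, folded form_operator_def]
    have h: "?h \<in> ?M" "\<forall>g\<in>?M. L2_inner ?h g = vG2v_form V f g" by (rule conjunct1, rule conjunct2)
    show ?thesis
    proof
      assume "ae_eq ?h (\<lambda>x. 0)"
      from L2_inner_cong[OF this ae_eq_refl, of f] have "L2_inner ?h f = 0" by (simp add: L2_inner_def)
      with h(2) f have "L2_inner ?w f = 0" by (simp add: form[OF f])
      moreover have "L2_inner ?w f = - 2 * (\<Sum>j\<in>UNIV. of_real ((norm (v_moment f j))\<^sup>2))"
      proof -
        have "L2_inner ?w f = (\<Sum>j\<in>UNIV. - 2 * v_moment f j * L2_inner (\<lambda>x. of_real (x $ j) * vC x) f)"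
          unfolding L2_inner_def sum_distrib_right mult.assoc[of "- 2 * v_moment f _"]
          by (subst Bochner_Integration.integral_sum)
             (intro integrable_mult_right L2_inner_integrable coordinate_v_L2 fL, simp only: integral_mult_right_zero)
        also have "\<dots> = (\<Sum>j\<in>UNIV. - 2 * (v_moment f j * cnj (v_moment f j)))"
          unfolding v_moment_def L2_inner_cnj by (simp only: mult.assoc)
        finally show ?thesis by (simp only: complex_norm_square sum_distrib_left)
      qed
      ultimately have "complex_of_real (\<Sum>j\<in>UNIV. (norm (v_moment f j))\<^sup>2) = 0" by simp
      then have "(\<Sum>j\<in>UNIV. (norm (v_moment f j))\<^sup>2) = 0" by (simp only: of_real_eq_0_iff)
      then show "\<forall>j. v_moment f j = 0" by (simp add: sum_nonneg_eq_0_iff)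
    next
      assume "\<forall>j. v_moment f j = 0"
      then have "L2_inner ?h ?h = 0" using h form[OF h(1)] by (simp add: L2_inner_def)
      then show "ae_eq ?h (\<lambda>x. 0)" by (simp add: L2_inner_self_eq_0_iff[OF perp_L2[OF h(1)]])
    qed
  qed
  then show ?thesis
    unfolding kernel_on_def L2_range_S2 by (auto simp: mem_S3_iff)
qed

lemma L2_range_S3: "L2_range (op_S3 V) = perp S3_constraints"
  unfolding op_S3_def kernel_S2vG2vS2 by (rule L2_range_orth_proj_perp[OF constraints_L2(3)])

lemma S3_within_S1:
  assumes "f \<in> perp S1_constraints"
  shows "f \<in> L2_range (op_S3 V) \<longleftrightarrow> v_coeff (op_T V f) = 0 \<and> (\<forall>j. v_moment f j = 0)"
  using assms by (simp add: L2_range_S3 mem_S3_iff mem_S2_iff)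

section \<open>Behaviour at infinity and membership in \<open>L\<^sup>p\<close>\<close>

text \<open>
  Orthogonality to \<open>v\<close> removes the term \<open>log \<bar>x\<bar> \<integral> v f\<close>. The estimate of the kernel fails at \<open>y = x\<close>,
  where the logarithm takes its default value \<open>0\<close>, and is therefore used almost everywhere.
\<close>

lemma log_potential_expansion:
  assumes f: "f \<in> L2" and f0: "L2_inner f vC = 0"
  shows "\<exists>K. \<forall>x. x \<noteq> 0 \<longrightarrow>
    norm (log_potential f x + (\<Sum>j\<in>UNIV. of_real (x $ j) * v_moment f j) / of_real ((norm x)\<^sup>2)) \<le> K / (norm x)\<^sup>2"
proof -
  let ?J = japanese_bracket
  let ?m = "\<lambda>y. (?J y)\<^sup>2 * (v V y * norm (f y))"
  let ?s = "\<lambda>x y. ?J y ^ 3 * (v V y * norm (f y)) / norm (x - y)"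
  from singular_potential_bound[OF f] obtain K where
    K: "\<And>x. integrable lebesgue (?s x)" "\<And>x. integral\<^sup>L lebesgue (?s x) \<le> K" by blast
  have mi: "integrable lebesgue ?m" by (rule second_moment_integrable[OF f])
  let ?M = "integral\<^sup>L lebesgue ?m"
  have main: "norm (log_potential f x + (\<Sum>j\<in>UNIV. of_real (x $ j) * v_moment f j) / of_real ((norm x)\<^sup>2))
      \<le> (13 * ?M + 8 * K) / (norm x)\<^sup>2" if x: "x \<noteq> 0" for x
  proof -
    let ?X = "(norm x)\<^sup>2"
    let ?k = "\<lambda>y. ln (norm (x - y)) - ln (norm x) + (x \<bullet> y) / ?X"
    let ?F = "\<lambda>y. complex_of_real (?k y) * (vC y * f y)"
    let ?c = "\<lambda>j. complex_of_real (x $ j / ?X)"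
    have X: "0 < ?X" using x by simp
    have lx: "integrable lebesgue (\<lambda>y. complex_of_real (ln (norm (x - y))) * (vC y * f y))"
      by (rule log_potential_integrable[OF f])
    have fv: "integrable lebesgue (\<lambda>y. f y * vC y)" by (rule L2_mult_integrable[OF f vC_L2])
    have fx: "integrable lebesgue (\<lambda>y. f y * (complex_of_real (y $ j) * vC y))" for j
      by (rule L2_mult_integrable[OF f coordinate_v_L2])
    have zero: "(LINT y|lebesgue. f y * vC y) = 0" using f0 by (simp add: L2_inner_def)
    have mom: "(LINT y|lebesgue. f y * (complex_of_real (y $ j) * vC y)) = v_moment f j" for j
      by (simp add: v_moment_def L2_inner_def)
    have dot: "complex_of_real ((x \<bullet> y) / ?X) = (\<Sum>j\<in>UNIV. ?c j * of_real (y $ j))" for y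
      by (simp add: inner_vec_def sum_divide_distrib)
    have F: "?F y = complex_of_real (ln (norm (x - y))) * (vC y * f y)
        - complex_of_real (ln (norm x)) * (f y * vC y)
        + (\<Sum>j\<in>UNIV. ?c j * (f y * (complex_of_real (y $ j) * vC y)))" for y
      unfolding of_real_add of_real_diff dot by (simp add: algebra_simps sum_distrib_left sum_distrib_right)
    have "integral\<^sup>L lebesgue ?F = log_potential f x
        - complex_of_real (ln (norm x)) * (LINT y|lebesgue. f y * vC y) + (\<Sum>j\<in>UNIV. ?c j * v_moment f j)"
      unfolding F log_potential_def
      by (simp only: Bochner_Integration.integral_add Bochner_Integration.integral_diff
          Bochner_Integration.integral_sum Bochner_Integration.integrable_diff
          Bochner_Integration.integrable_sum integral_mult_right_zero integrable_mult_right lx fv fx mom)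
    then have FI: "integral\<^sup>L lebesgue ?F
        = log_potential f x + (\<Sum>j\<in>UNIV. of_real (x $ j) * v_moment f j) / of_real ?X"
      unfolding zero by (simp add: sum_divide_distrib)
    let ?g = "\<lambda>y. 13 / ?X * ?m y + 8 / ?X * ?s x y"
    have gi: "integrable lebesgue ?g"
      by (intro Bochner_Integration.integrable_add integrable_mult_right mi K(1))
    have gI: "integral\<^sup>L lebesgue ?g \<le> (13 * ?M + 8 * K) / ?X"
    proof -
      have "integral\<^sup>L lebesgue ?g = 13 / ?X * ?M + 8 / ?X * integral\<^sup>L lebesgue (?s x)"
        by (simp only: Bochner_Integration.integral_add integral_mult_right_zero integrable_mult_right mi K(1))
      also have "\<dots> \<le> 13 / ?X * ?M + 8 / ?X * K"
        using X K(2)[of x] by (intro add_left_mono mult_left_mono) auto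
      finally show ?thesis by (simp add: add_divide_distrib)
    qed
    have bound: "norm (?F y) \<le> ?g y" if y: "y \<noteq> x" for y
    proof -
      let ?w = "v V y * norm (f y)"
      have w: "0 \<le> ?w" using v_nonneg by simp
      have "?X * \<bar>?k y\<bar> \<le> 13 * (norm y)\<^sup>2 + 8 * (norm y) ^ 3 / norm (x - y)"
        using x y by (intro log_kernel_expansion) auto
      also have "\<dots> \<le> 13 * (?J y)\<^sup>2 + 8 * (?J y) ^ 3 / norm (x - y)"
        by (intro add_mono mult_left_mono divide_right_mono power_mono norm_le_japanese_bracket) auto
      finally have "?X * \<bar>?k y\<bar> * ?w \<le> (13 * (?J y)\<^sup>2 + 8 * (?J y) ^ 3 / norm (x - y)) * ?w"
        using w by (intro mult_right_mono)
      then have "\<bar>?k y\<bar> * ?w \<le> (13 * (?J y)\<^sup>2 + 8 * (?J y) ^ 3 / norm (x - y)) * ?w / ?X"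
        using X by (simp only: pos_le_divide_eq mult.commute mult.left_commute)
      also have "\<dots> = ?g y" by (simp add: algebra_simps add_divide_distrib)
      finally show ?thesis
        by (simp only: norm_mult norm_of_real abs_of_nonneg[OF v_nonneg])
    qed
    have ae: "AE y in lebesgue. norm (?F y) \<le> ?g y"
      using AE_completion[OF AE_lborel_singleton[of x]] by eventually_elim (rule bound)
    have Fi: "integrable lebesgue ?F"
      unfolding F by (intro Bochner_Integration.integrable_add Bochner_Integration.integrable_diff
        Bochner_Integration.integrable_sum integrable_mult_right lx fv fx)
    have "norm (integral\<^sup>L lebesgue ?F) \<le> integral\<^sup>L lebesgue ?g"
      by (rule integrable_lebesgue_bound(2)[OF gi borel_measurable_integrable[OF Fi] ae])
    with gI show ?thesis unfolding FI by linarith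
  qed
  then show ?thesis by blast
qed

end

lemma Lp_of_inverse_square_decay:
  assumes m: "\<psi> \<in> borel_measurable lebesgue"
    and bound: "\<And>x. norm (\<psi> x) \<le> C * japanese_bracket x powr (- 2)"
    and p: "2 < p"
  shows "\<psi> \<in> Lp p"
proof (cases p)
  case PInf
  have C: "0 \<le> C"
    using order_trans[OF norm_ge_zero bound[of 0]] by (simp add: japanese_bracket_def)
  have "norm (\<psi> x) \<le> C" for x
  proof -
    have "japanese_bracket x powr (- 2) \<le> 1 powr (- 2)"
      using japanese_bracket_ge_1 by (intro powr_mono2') auto
    then have "C * japanese_bracket x powr (- 2) \<le> C * 1" using C by (intro mult_left_mono) auto
    with bound[of x] show ?thesis by linarith
  qed
  then have "\<exists>C. AE x in lebesgue. norm (\<psi> x) \<le> C" by (intro exI[of _ C]) simp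
  with m show ?thesis unfolding Lp_def PInf by simp
next
  case (real r)
  have r: "2 < r" using p unfolding real by (simp add: numeral_eq_ereal)
  have C: "0 \<le> C"
    using order_trans[OF norm_ge_zero bound[of 0]] by (simp add: japanese_bracket_def)
  have "integrable lebesgue (\<lambda>x. norm (\<psi> x) powr r)"
  proof (rule integrable_lebesgue_bound(1))
    show "integrable lebesgue (\<lambda>x. C powr r * japanese_bracket x powr (- (2 * r)))"
      using r by (intro integrable_mult_right integrable_japanese_bracket) auto
    show "(\<lambda>x. norm (\<psi> x) powr r) \<in> borel_measurable lebesgue" using m by measurable
    have "norm (norm (\<psi> x) powr r) \<le> C powr r * japanese_bracket x powr (- (2 * r))" for x
    proof -
      have "norm (\<psi> x) powr r \<le> (C * japanese_bracket x powr (- 2)) powr r"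
        using r by (intro powr_mono2 bound) auto
      also have "\<dots> = C powr r * japanese_bracket x powr (- (2 * r))"
        using C by (simp add: powr_mult powr_powr)
      finally show ?thesis by simp
    qed
    then show "AE x in lebesgue. norm (norm (\<psi> x) powr r) \<le> C powr r * japanese_bracket x powr (- (2 * r))"
      by simp
  qed
  with m show ?thesis unfolding Lp_def real by simp
qed (use p in simp)

text \<open>
  The ball of radius \<open>t r\<close> has volume of order \<open>t\<^sup>4\<close> and the cube of the lower bound is of order
  \<open>t\<^sup>-\<^sup>3\<close>, so the integral over the ball is unbounded as \<open>t\<close> grows.
\<close>

lemma not_Lp3_of_conic_lower_bound:
  assumes "0 < c" "0 < r"
    and low: "\<And>t x. t0 \<le> t \<Longrightarrow> dist (t *\<^sub>R e) x < t * r \<Longrightarrow> c / t \<le> norm (\<psi> x)"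
  shows "\<psi> \<notin> Lp 3"
proof
  assume "\<psi> \<in> Lp 3"
  then have i: "integrable lebesgue (\<lambda>x. norm (\<psi> x) powr 3)"
    by (simp add: Lp_def numeral_eq_ereal)
  define I where "I = (LINT x|lebesgue. norm (\<psi> x) powr 3)"
  let ?u = "unit_ball_vol 4"
  let ?q = "c ^ 3 * (?u * r ^ 4)"
  have q: "0 < ?q" using assms(1,2) by simp
  have bound: "?q * t \<le> I" if t: "0 < t" "t0 \<le> t" for t
  proof -
    let ?B = "ball (t *\<^sub>R e) (t * r)"
    have vol: "measure lebesgue ?B = ?u * (t * r) ^ 4"
      using content_ball[of "t * r" "t *\<^sub>R e"] t assms(2) by simp
    have "?q * t = (c / t) ^ 3 * measure lebesgue ?B"
      unfolding vol using t by (simp add: power_divide field_simps numeral_eq_Suc)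
    also have "\<dots> = (LINT x|lebesgue. (c / t) ^ 3 * indicator ?B x)" by simp
    also have "\<dots> \<le> I"
      unfolding I_def
    proof (rule integral_mono)
      have "integrable lebesgue (indicator ?B :: R4 \<Rightarrow> real)"
        by (intro integrable_real_indicator) (use t assms(2) in \<open>auto simp: emeasure_ball\<close>)
      then show "integrable lebesgue (\<lambda>x. (c / t) ^ 3 * indicator ?B x)" by (intro integrable_mult_right)
      show "(c / t) ^ 3 * indicator ?B x \<le> norm (\<psi> x) powr 3" for x
      proof (cases "x \<in> ?B")
        case True
        then have "c / t \<le> norm (\<psi> x)" using low t by simp
        then have "(c / t) ^ 3 \<le> norm (\<psi> x) ^ 3" using assms(1) t by (intro power_mono) auto
        also have "\<dots> = norm (\<psi> x) powr 3" by (simp add: powr_numeral)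
        finally show ?thesis using True by simp
      qed simp
    qed (rule i)
    finally show ?thesis .
  qed
  define t where "t = max (max 1 t0) ((I + 1) / ?q)"
  have t: "0 < t" "t0 \<le> t" "(I + 1) / ?q \<le> t" by (auto simp: t_def)
  have "I + 1 \<le> ?q * t" using t(3) q by (simp only: pos_divide_le_eq mult.commute)
  with bound[OF t(1,2)] show False by linarith
qed

text \<open>
  If \<open>c \<noteq> 0\<close>, then \<open>\<bar>\<psi>\<bar>\<close> is eventually at least \<open>\<bar>c\<bar>/2\<close> in every direction. If \<open>c = 0\<close> and \<open>b\<^sub>j \<noteq> 0\<close>,
  the profile \<open>\<Sum>\<^sub>i x\<^sub>i b\<^sub>i / \<bar>x\<bar>\<^sup>2\<close> has size of order \<open>1/\<bar>x\<bar>\<close> in a narrow cone around the \<open>j\<close>-th axis and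
  beats the remainder there.
\<close>

lemma asymptotic_profile_eq_0:
  fixes b :: "4 \<Rightarrow> complex" and K :: real
  assumes L3: "\<psi> \<in> Lp 3"
    and exp: "\<And>x. x \<noteq> 0 \<Longrightarrow> norm (\<psi> x - (c + (\<Sum>j\<in>UNIV. of_real (x $ j) * b j) / of_real ((norm x)\<^sup>2))) \<le> K / (norm x)\<^sup>2"
  shows "c = 0 \<and> (\<forall>j. b j = 0)"
proof -
  define B where "B = (\<Sum>j\<in>UNIV. norm (b j))"
  have B0: "0 \<le> B" unfolding B_def by (simp add: sum_nonneg)
  have lin: "norm (\<Sum>j\<in>UNIV. complex_of_real (z $ j) * b j) \<le> norm z * B" for z :: R4
  proof -
    have "norm (\<Sum>j\<in>UNIV. complex_of_real (z $ j) * b j) \<le> (\<Sum>j\<in>UNIV. norm (complex_of_real (z $ j) * b j))"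
      by (rule norm_sum)
    also have "\<dots> \<le> (\<Sum>j\<in>UNIV. norm z * norm (b j))"
      by (intro sum_mono) (simp add: norm_mult mult_right_mono component_le_norm_cart)
    finally show ?thesis by (simp add: B_def sum_distrib_left)
  qed
  have K0: "0 \<le> K"
    using order_trans[OF norm_ge_zero exp[of "axis 1 1"]] by simp
  \<comment> \<open>Both lower bounds below are on a ball of radius at most \<open>t / 2\<close> around \<open>t\<close> times a unit vector.\<close>
  have geo: "t / 2 \<le> norm x" "norm x \<le> 2 * t" "x \<noteq> 0" "K / (norm x)\<^sup>2 \<le> 4 * K / t\<^sup>2"
    if "dist (t *\<^sub>R e) x < t * r" "norm e = 1" "r \<le> 1/2" "0 < t" for t r :: real and e x :: R4
  proof -
    have "t * r \<le> t / 2" using that mult_left_mono[of r "1/2" t] by simp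
    with that(1) have d: "norm (t *\<^sub>R e - x) < t / 2" unfolding dist_norm by (rule less_le_trans)
    have te: "norm (t *\<^sub>R e) = t" using that by simp
    show 1: "t / 2 \<le> norm x" using norm_triangle_ineq2[of "t *\<^sub>R e" x] d te by linarith
    show "norm x \<le> 2 * t" using norm_triangle_ineq2[of x "t *\<^sub>R e"] d te that(4) by (simp add: norm_minus_commute)
    show nz: "x \<noteq> 0" using 1 that(4) by auto
    have "(t / 2)\<^sup>2 \<le> (norm x)\<^sup>2" using 1 that(4) by (intro power_mono) auto
    then have "K / (norm x)\<^sup>2 \<le> K / (t / 2)\<^sup>2" 
      using K0 that(4) nz by (intro divide_left_mono mult_pos_pos zero_less_power) auto
    then show "K / (norm x)\<^sup>2 \<le> 4 * K / t\<^sup>2" by (simp add: power_divide mult.commute)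
  qed
  have c0: "c = 0"
  proof (rule ccontr)
    assume c: "c \<noteq> 0"
    \<comment> \<open>From here on profile and remainder together use up at most half of \<open>norm c\<close>.\<close>
    define t0 where "t0 = max 1 ((4 * B + 8 * K) / norm c)"
    have "\<psi> \<notin> Lp 3"
    proof (rule not_Lp3_of_conic_lower_bound)
      show "0 < norm c / 2" "0 < (1/2 :: real)" using c by auto
      fix t :: real and x :: R4
      assume t: "t0 \<le> t" and d: "dist (t *\<^sub>R axis 1 1) x < t * (1/2)"
      have t1: "1 \<le> t" "(4 * B + 8 * K) / norm c \<le> t" using t by (auto simp: t0_def)
      have g: "t / 2 \<le> norm x" "x \<noteq> 0" "K / (norm x)\<^sup>2 \<le> 4 * K / t\<^sup>2"
        using geo[OF d] t1 by auto
      let ?s = "(\<Sum>j\<in>UNIV. complex_of_real (x $ j) * b j) / of_real ((norm x)\<^sup>2)"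
      have "norm ?s \<le> norm x * B / (norm x)\<^sup>2"
        using lin[of x] by (simp add: norm_divide divide_right_mono norm_power)
      also have "\<dots> = B / norm x" using g(2) by (simp add: power2_eq_square)
      also have "\<dots> \<le> B / (t / 2)" using B0 g t1 by (intro divide_left_mono mult_pos_pos) auto
      finally have s: "norm ?s \<le> 2 * B / t" by (simp add: mult.commute)
      have "t * 1 \<le> t\<^sup>2" using t1 unfolding power2_eq_square by (intro mult_left_mono) auto
      then have "4 * K / t\<^sup>2 \<le> 4 * K / t" using K0 t1 by (intro divide_left_mono mult_pos_pos) auto
      then have e: "norm (\<psi> x - (c + ?s)) \<le> 4 * K / t" using exp[OF g(2)] g(3) by linarith
      have "4 * B + 8 * K \<le> t * norm c" using t1(2) c by (simp add: pos_divide_le_eq)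
      then have "(2 * B + 4 * K) / t \<le> norm c / 2" using t1(1) by (simp add: field_simps)
      then have small: "2 * B / t + 4 * K / t \<le> norm c / 2" by (simp add: add_divide_distrib)
      have "norm c \<le> norm (\<psi> x) + norm ?s + norm (\<psi> x - (c + ?s))"
      proof -
        have "c = \<psi> x - ?s - (\<psi> x - (c + ?s))" by simp
        then have "norm c = norm (\<psi> x - ?s - (\<psi> x - (c + ?s)))" by simp
        also have "\<dots> \<le> norm (\<psi> x - ?s) + norm (\<psi> x - (c + ?s))" by (rule norm_triangle_ineq4)
        also have "norm (\<psi> x - ?s) \<le> norm (\<psi> x) + norm ?s" by (rule norm_triangle_ineq4)
        finally show ?thesis by simp
      qed
      with s e small have "norm c / 2 \<le> norm (\<psi> x)" by linarith
      moreover have "norm c / 2 / t \<le> norm c / 2" 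
        using divide_left_mono[of 1 t "norm c / 2"] t1(1) by simp
      ultimately show "norm c / 2 / t \<le> norm (\<psi> x)" by linarith
    qed
    with L3 show False by contradiction
  qed
  have "b j = 0" for j
  proof (rule ccontr)
    assume b: "b j \<noteq> 0"
    have bB: "norm (b j) \<le> B" unfolding B_def by (intro member_le_sum) auto
    have nb: "0 < norm (b j)" using b by simp
    have Bpos: "0 < B" using bB nb by linarith
    \<comment> \<open>Within distance \<open>t * r\<close> of \<open>t\<close> times the axis, the linear form deviates from \<open>t * b j\<close>
        by at most half.\<close>
    define r where "r = norm (b j) / (2 * B)"
    have r: "0 < r" "r \<le> 1/2" using nb Bpos bB by (auto simp: r_def field_simps)
    \<comment> \<open>From here on the remainder is at most half of the lower bound \<open>norm (b j) / (8 * t)\<close> for the profile.\<close>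
    define t0 where "t0 = max 1 (64 * K / norm (b j))"
    have "\<psi> \<notin> Lp 3"
    proof (rule not_Lp3_of_conic_lower_bound)
      show "0 < norm (b j) / 16" "0 < r" using nb r by auto
      fix t :: real and x :: R4
      assume t: "t0 \<le> t" and d: "dist (t *\<^sub>R axis j 1) x < t * r"
      have t1: "1 \<le> t" "64 * K / norm (b j) \<le> t" using t by (auto simp: t0_def)
      have g: "norm x \<le> 2 * t" "x \<noteq> 0" "K / (norm x)\<^sup>2 \<le> 4 * K / t\<^sup>2"
        using geo[OF d] t1 r by auto
      let ?S = "\<lambda>x. \<Sum>j\<in>UNIV. complex_of_real (x $ j) * b j"
      have Sa: "?S (t *\<^sub>R axis j 1) = of_real t * b j"
      proof -
        have "complex_of_real ((t *\<^sub>R axis j 1 :: R4) $ i) * b i = (if i = j then of_real t * b j else 0)" for i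
          by (simp add: axis_def)
        then show ?thesis by simp
      qed
      have "?S (t *\<^sub>R axis j 1) - ?S x = ?S (t *\<^sub>R axis j 1 - x)"
        by (simp add: sum_subtractf left_diff_distrib)
      then have "norm (?S (t *\<^sub>R axis j 1) - ?S x) \<le> norm (t *\<^sub>R axis j 1 - x) * B"
        using lin[of "t *\<^sub>R axis j 1 - x"] by (simp only:)
      also have "\<dots> \<le> t * r * B" using d B0 by (intro mult_right_mono) (auto simp: dist_norm)
      also have "\<dots> = t * norm (b j) / 2" using Bpos by (simp add: r_def)
      finally have "norm (of_real t * b j) - norm (?S x) \<le> t * norm (b j) / 2"
        unfolding Sa using norm_triangle_ineq2[of "of_real t * b j" "?S x"] by linarith
      then have S: "t * norm (b j) / 2 \<le> norm (?S x)" using t1 by (simp add: norm_mult)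
      have "t * norm (b j) / 2 / (2 * t)\<^sup>2 \<le> norm (?S x) / (norm x)\<^sup>2"
        using S g t1 by (intro frac_le power_mono) auto
      then have s: "norm (b j) / (8 * t) \<le> norm (?S x / of_real ((norm x)\<^sup>2))"
        using t1 by (simp add: norm_divide norm_power power2_eq_square[of t] power_mult_distrib)
      have "norm (?S x / of_real ((norm x)\<^sup>2)) \<le> norm (\<psi> x) + K / (norm x)\<^sup>2"
        using exp[OF g(2)] norm_triangle_ineq2[of "?S x / of_real ((norm x)\<^sup>2)" "\<psi> x"]
        by (simp add: c0 norm_minus_commute)
      with s g(3) have low: "norm (b j) / (8 * t) - 4 * K / t\<^sup>2 \<le> norm (\<psi> x)" by linarith
      have "64 * K \<le> t * norm (b j)" using t1(2) nb by (simp only: pos_divide_le_eq)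
      then have "4 * K / t\<^sup>2 \<le> norm (b j) / (16 * t)"
        using t1 by (simp add: power2_eq_square field_simps)
      moreover have "norm (b j) / (8 * t) = 2 * (norm (b j) / (16 * t))" by simp
      ultimately have "norm (b j) / (16 * t) \<le> norm (\<psi> x)" using low by linarith
      then show "norm (b j) / 16 / t \<le> norm (\<psi> x)" by simp
    qed
    with L3 show False by contradiction
  qed
  with c0 show ?thesis by blast
qed

theorem lemma7p5:
  fixes V :: "R4 \<Rightarrow> real" and \<phi> \<psi> :: "R4 \<Rightarrow> complex" and c\<^sub>0 :: complex
  assumes V_meas: "V \<in> borel_measurable lebesgue"
    and V_nonzero: "\<not> (AE x in lebesgue. V x = 0)"
    and v_decay: "decays_beyond (v V) 4"
    and \<phi>: "\<phi> \<in> L2_range (op_S1 V)"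
    and c\<^sub>0_eq: "c\<^sub>0 = of_real (1 / (LINT x|lebesgue. \<bar>V x\<bar>))
      * (LINT x|lebesgue. of_real (v V x) * op_T V \<phi> x)"
    and \<psi>_eq: "\<psi> = (\<lambda>x. c\<^sub>0 - G1 (\<lambda>y. of_real (v V y) * \<phi> y) x)"
  shows "ae_eq \<phi> (\<lambda>x. of_real (U V x) * of_real (v V x) * \<psi> x)
    \<and> (\<phi> \<in> L2_range (op_S3 V) \<longleftrightarrow> (\<forall>p::ereal. 2 < p \<and> p \<le> \<infinity> \<longrightarrow> \<psi> \<in> Lp p))"
proof -
  interpret decaying_potential V
    by unfold_locales (fact V_meas V_nonzero v_decay)+
  define \<kappa> where "\<kappa> = 1 / (8 * pi\<^sup>2)"
  have \<kappa>: "0 < \<kappa>" by (simp add: \<kappa>_def)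
  have S1: "\<phi> \<in> perp S1_constraints" using \<phi> by (simp only: L2_range_S1)
  then have orth: "L2_inner \<phi> vC = 0" and T: "ae_eq (op_T V \<phi>) (\<lambda>x. v_coeff (op_T V \<phi>) * vC x)"
    unfolding mem_S1_iff by (simp_all add: perp_def)
  have \<phi>L2: "\<phi> \<in> L2" using S1 by (rule perp_L2)
  have c: "c\<^sub>0 = v_coeff (op_T V \<phi>)"
    unfolding c\<^sub>0_eq v_coeff_def L2_inner_def sqnorm_vC by (simp add: mult.commute)
  have \<psi>: "\<psi> x = c\<^sub>0 + of_real \<kappa> * log_potential \<phi> x" for x
    unfolding \<psi>_eq G1_eq_log_potential \<kappa>_def by simp
  have ae: "ae_eq \<phi> (\<lambda>x. of_real (U V x) * of_real (v V x) * \<psi> x)"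
    using T unfolding ae_eq_def c[symmetric]
  proof eventually_elim
    case (elim x)
    have UU: "complex_of_real (U V x) * of_real (U V x) = 1" by (simp add: U_def)
    have "of_real (U V x) * \<phi> x = vC x * \<psi> x"
      using elim unfolding op_T_eq \<psi> \<kappa>_def by (simp add: algebra_simps)
    then have "of_real (U V x) * (of_real (U V x) * \<phi> x) = of_real (U V x) * (vC x * \<psi> x)" by simp
    then show ?case using UU by (simp add: mult.assoc[symmetric])
  qed
  from log_potential_expansion[OF \<phi>L2 orth] obtain K where K: "\<And>x. x \<noteq> 0 \<Longrightarrow>
    norm (log_potential \<phi> x + (\<Sum>j\<in>UNIV. of_real (x $ j) * v_moment \<phi> j) / of_real ((norm x)\<^sup>2)) \<le> K / (norm x)\<^sup>2"
    by blast
  have S3: "\<phi> \<in> L2_range (op_S3 V) \<longleftrightarrow> c\<^sub>0 = 0 \<and> (\<forall>j. v_moment \<phi> j = 0)"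
    unfolding S3_within_S1[OF S1] c ..
  have "\<phi> \<in> L2_range (op_S3 V) \<longleftrightarrow> (\<forall>p::ereal. 2 < p \<and> p \<le> \<infinity> \<longrightarrow> \<psi> \<in> Lp p)"
  proof
    assume "\<phi> \<in> L2_range (op_S3 V)"
    with S3 have 0: "c\<^sub>0 = 0" "\<And>j. v_moment \<phi> j = 0" by auto
    obtain M where M: "0 \<le> M" "\<And>x. norm (log_potential \<phi> x) \<le> M * japanese_bracket x"
      using log_potential_bound[OF \<phi>L2] by blast
    \<comment> \<open>Outside the unit ball the expansion gives the term with \<open>K\<close>; inside it the bound
        \<open>M\<langle>x\<rangle>\<close> gives the other, because \<open>\<langle>x\<rangle>\<^sup>3 \<le> 4\<close> there.\<close>
    let ?C = "\<kappa> * (2 * \<bar>K\<bar> + 4 * M)"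
    have bound: "norm (\<psi> x) \<le> ?C * japanese_bracket x powr (- 2)" for x
    proof -
      let ?J = "japanese_bracket x"
      have J: "0 < ?J" "?J\<^sup>2 = 1 + (norm x)\<^sup>2"
        using japanese_bracket_pos[of x] by (auto simp: japanese_bracket_def)
      have "norm (log_potential \<phi> x) \<le> (2 * \<bar>K\<bar> + 4 * M) / ?J\<^sup>2"
      proof (cases "1 \<le> norm x")
        case True
        then have x: "x \<noteq> 0" by auto
        have "norm (log_potential \<phi> x) \<le> \<bar>K\<bar> / (norm x)\<^sup>2"
          using K[OF x] 0(2) by (auto intro: order_trans simp: divide_right_mono)
        also have "\<dots> = 2 * \<bar>K\<bar> / (2 * (norm x)\<^sup>2)" by simp
        also have "\<dots> \<le> 2 * \<bar>K\<bar> / ?J\<^sup>2"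
        proof (rule divide_left_mono)
          have "1 \<le> (norm x)\<^sup>2" using True by (simp add: one_le_power)
          then show "?J\<^sup>2 \<le> 2 * (norm x)\<^sup>2" unfolding J(2) by simp
          show "0 < 2 * (norm x)\<^sup>2 * ?J\<^sup>2" using J(1) x by simp
        qed simp
        also have "\<dots> \<le> (2 * \<bar>K\<bar> + 4 * M) / ?J\<^sup>2" using M(1) by (intro divide_right_mono) auto
        finally show ?thesis .
      next
        case False
        then have "(norm x)\<^sup>2 \<le> 1" by (simp add: power_le_one)
        then have J2: "?J\<^sup>2 \<le> 2" unfolding J(2) by simp
        have "?J \<le> ?J\<^sup>2" using japanese_bracket_ge_1[of x] by (intro self_le_power) auto
        with J2 have "?J * ?J\<^sup>2 \<le> 2 * 2" using J(1) by (intro mult_mono) auto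
        then have "M * (?J * ?J\<^sup>2) \<le> M * 4" using M(1) by (intro mult_left_mono) auto
        then have "M * ?J \<le> 4 * M / ?J\<^sup>2" using J(1) by (simp add: field_simps)
        also have "\<dots> \<le> (2 * \<bar>K\<bar> + 4 * M) / ?J\<^sup>2" by (intro divide_right_mono) auto
        finally show ?thesis using M(2)[of x] by linarith
      qed
      then have "\<kappa> * norm (log_potential \<phi> x) \<le> \<kappa> * ((2 * \<bar>K\<bar> + 4 * M) / ?J\<^sup>2)"
        using \<kappa> by (intro mult_left_mono) auto
      moreover have "?J powr (- 2) = 1 / ?J\<^sup>2" using J(1) by (simp add: powr_minus_divide powr_numeral)
      ultimately show ?thesis using \<kappa> unfolding \<psi> 0(1) by (simp add: norm_mult)
    qed
    have m: "\<psi> \<in> borel_measurable lebesgue"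
    proof -
      have "(\<lambda>x. c\<^sub>0 + of_real \<kappa> * log_potential \<phi> x) \<in> borel_measurable lebesgue"
        using log_potential_measurable[OF \<phi>L2] by measurable
      then show ?thesis by (simp only: \<psi>[symmetric])
    qed
    show "\<forall>p::ereal. 2 < p \<and> p \<le> \<infinity> \<longrightarrow> \<psi> \<in> Lp p"
      using Lp_of_inverse_square_decay[OF m bound] by blast
  next
    assume "\<forall>p::ereal. 2 < p \<and> p \<le> \<infinity> \<longrightarrow> \<psi> \<in> Lp p"
    then have L3: "\<psi> \<in> Lp 3" by (simp add: numeral_eq_ereal)
    have "norm (\<psi> x - (c\<^sub>0 + (\<Sum>j\<in>UNIV. of_real (x $ j) * (- of_real \<kappa> * v_moment \<phi> j)) / of_real ((norm x)\<^sup>2)))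
        \<le> \<kappa> * K / (norm x)\<^sup>2" if x: "x \<noteq> 0" for x
    proof -
      let ?S = "\<Sum>j\<in>UNIV. complex_of_real (x $ j) * v_moment \<phi> j"
      have "(\<Sum>j\<in>UNIV. complex_of_real (x $ j) * (- of_real \<kappa> * v_moment \<phi> j)) = - of_real \<kappa> * ?S"
        by (simp add: sum_distrib_left sum_negf ac_simps)
      then have "\<psi> x - (c\<^sub>0 + (\<Sum>j\<in>UNIV. of_real (x $ j) * (- of_real \<kappa> * v_moment \<phi> j)) / of_real ((norm x)\<^sup>2))
          = of_real \<kappa> * (log_potential \<phi> x + ?S / of_real ((norm x)\<^sup>2))"
        unfolding \<psi> by (simp add: algebra_simps)
      also have "norm \<dots> \<le> \<kappa> * (K / (norm x)\<^sup>2)"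
        unfolding norm_mult using K[OF x] \<kappa> by (intro mult_mono) auto
      finally show ?thesis by simp
    qed
    from asymptotic_profile_eq_0[OF L3 this] have "c\<^sub>0 = 0" "\<And>j. of_real \<kappa> * v_moment \<phi> j = 0" by auto
    with \<kappa> show "\<phi> \<in> L2_range (op_S3 V)" unfolding S3 by auto
  qed
  with ae show ?thesis by blast
qed

end
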